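(* Let $k\ge 2$ be an integer and suppose that $0<\epsilon\le 1/23$. Then the query complexity of any $\epsilon$-tester for the class of abelian groups generated by $k$ elements (i.e., groups isomorphic to $\mathbb Z_{m_1}\times\cdots\times\mathbb Z_{m_r}$ with $1\le r\le k$ and positive integers $m_i$) is $\Omega(|\Gamma|^{\frac16-\frac{2}{6(3k+2)}})$ if $k$ is even and $\Omega(|\Gamma|^{\frac16-\frac{4}{6(3k+1)}})$ if $k$ is odd. Moreover, these bounds hold with respect to either the Hamming distance or the edit distance, and even when $|\Gamma|$ is known to the tester.
   Context: A magma $(\Gamma,\circ)$ is a finite set $\Gamma$ with a binary operation $\circ\colon\Gamma\times\Gamma\to\Gamma$. Hamming distance: for two magmas $(\Gamma,\circ),(\Gamma,\ast)$ on the same set, $\mathrm{Ham}_\Gamma(\circ,\ast)=|\{(x,y)\in\Gamma\times\Gamma : x\circ y\neq x\ast y\}|$. Edit distance: a table of size $k$ is a function $T\colon\Pi\times\Pi\to\mathbb N$ with $\Pi\subseteq\mathbb N$, $|\Pi|=k$. Allowed operations: exchange (change one value $T(a,b)$ arbitrarily; cost $1$); insert (add a new $a\in\mathbb N\setminus\Pi$ to the domain, setting the $2k+1$ new values arbitrarily; cost $2k+1$); delete (remove some $a\in\Pi$, restricting $T$ to $(\Pi\setminus\{a\})^2$; cost $2k-1$). The edit distance between two tables is the minimum total cost to transform one into the other. A multiplication table for $(\Gamma,\circ)$ is a table $T\colon\Pi\times\Pi\to\mathbb N$ with $|\Pi|=|\Gamma|$ together with a bijection $\sigma\colon\Pi\to\Gamma$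 such that $T(a,b)=\sigma^{-1}(\sigma(a)\circ\sigma(b))$. The edit distance $\mathrm{edit}((\Gamma,\circ),(\Gamma',\ast))$ between two magmas is the minimum edit distance between $T$ and $T'$ over all multiplication tables $T$ of $(\Gamma,\circ)$ and $T'$ of $(\Gamma',\ast)$. For a class $\mathscr C$ of groups, $(\Gamma,\circ)$ is $\delta$-far from $\mathscr C$ w.r.t. the Hamming distance if $\mathrm{Ham}_\Gamma(\circ,\ast)\ge\delta|\Gamma|^2$ for every operation $\ast$ on $\Gamma$ with $(\Gamma,\ast)$ a group in $\mathscr C$; it is $\delta$-far w.r.t. the edit distance if $\mathrm{edit}((\Gamma,\circ),(\Gamma',\ast))\ge\delta|\Gamma|^2$ for every group $(\Gamma',\ast)$ in $\mathscr C$. Binary structure: a binary structure for $(\Gamma,\circ)$ is a triple $(q,O_1,O_2)$ where $q\ge|\Gamma|$ is an integer and there is an injective map $\pi\colon\Gamma\to\Sigma=\{0,1\}^{\lceil\log_2 q\rceil}$ such that the oracle $O_1$ picks $x\in\Gamma$ uniformly at random and outputs $\pi(x)$, and the oracle $O_2$, on strings $z_1,z_2\in\pi(\Gamma)$, outputs $\pi(\pi^{-1}(z_1)\circ\pi^{-1}(z_2))$ (arbitrary on other strings). Each oracle call is one query. An $\epsilon$-tester (w.r.t. a given distance) for a class $\mathscr C$ is a randomized algorithm which, given any binary structure for a magma $(\Gamma,\circ)$, outputs PASS with probability at least $2/3$ if $(\Gamma,\circ)$ is a group in $\mathscr C$, and outputs FAIL with probability at least $2/3$ if $(\Gamma,\circ)$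 is $\epsilon$-far from $\mathscr C$ with respect to that distance. *)

theory Defs
  imports "HOL-Probability.Probability" "HOL-Algebra.Elementary_Groups" "HOL-Algebra.Product_Groups"
begin

(* A magma is a carrier set together with a curried operation, of which only the
   values on the carrier matter.  It is nonempty so that a uniformly random element exists. *)

definition magma :: "'a set \<Rightarrow> ('a \<Rightarrow> 'a \<Rightarrow> 'a) \<Rightarrow> bool" where
  "magma \<Gamma> f \<longleftrightarrow> finite \<Gamma> \<and> \<Gamma> \<noteq> {} \<and> (\<forall>x\<in>\<Gamma>. \<forall>y\<in>\<Gamma>. f x y \<in> \<Gamma>)"

definition abelian_generated_by :: "nat \<Rightarrow> 'a set \<Rightarrow> ('a \<Rightarrow> 'a \<Rightarrow> 'a) \<Rightarrow> bool" where
  "abelian_generated_by k \<Gamma> f \<longleftrightarrow>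
     (\<exists>e. comm_group \<lparr>carrier = \<Gamma>, monoid.mult = f, one = e\<rparr> \<and>
        (\<exists>r m. 1 \<le> r \<and> r \<le> k \<and> (\<forall>i<r. 0 < m i) \<and>
           \<lparr>carrier = \<Gamma>, monoid.mult = f, one = e\<rparr> \<cong>
             product_group {..<r} (\<lambda>i. integer_mod_group (m i))))"


definition Ham :: "'a set \<Rightarrow> ('a \<Rightarrow> 'a \<Rightarrow> 'a) \<Rightarrow> ('a \<Rightarrow> 'a \<Rightarrow> 'a) \<Rightarrow> nat" where
  "Ham \<Gamma> f g = card {(x, y) \<in> \<Gamma> \<times> \<Gamma>. f x y \<noteq> g x y}"


(* The table T : P x P -> nat is the pair of P and the partial function T with domain P x P. *)

type_synonym table = "nat set \<times> (nat \<times> nat \<rightharpoonup> nat)"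

definition is_table :: "table \<Rightarrow> bool" where
  "is_table S \<longleftrightarrow> finite (fst S) \<and> dom (snd S) = fst S \<times> fst S"

inductive edit_step :: "table \<Rightarrow> nat \<Rightarrow> table \<Rightarrow> bool" where
  exchange: "a \<in> P \<Longrightarrow> b \<in> P \<Longrightarrow> edit_step (P, T) 1 (P, T((a, b) \<mapsto> v))"
| insert: "a \<notin> P \<Longrightarrow> dom T' = insert a P \<times> insert a P \<Longrightarrow> T' |` (P \<times> P) = T \<Longrightarrow>
    edit_step (P, T) (2 * card P + 1) (insert a P, T')"
| delete: "a \<in> P \<Longrightarrow>
    edit_step (P, T) (2 * card P - 1) (P - {a}, T |` ((P - {a}) \<times> (P - {a})))"

inductive edit_path :: "table \<Rightarrow> nat \<Rightarrow> table \<Rightarrow> bool" where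
  refl: "edit_path S 0 S"
| step: "edit_path S c S' \<Longrightarrow> edit_step S' d S'' \<Longrightarrow> edit_path S (c + d) S''"

definition table_edit :: "table \<Rightarrow> table \<Rightarrow> nat" where
  "table_edit S S' = (LEAST c. edit_path S c S')"

definition multiplication_table :: "'a set \<Rightarrow> ('a \<Rightarrow> 'a \<Rightarrow> 'a) \<Rightarrow> table \<Rightarrow> bool" where
  "multiplication_table \<Gamma> f S \<longleftrightarrow> is_table S \<and>
     (\<exists>\<sigma>. bij_betw \<sigma> (fst S) \<Gamma> \<and>
        (\<forall>a\<in>fst S. \<forall>b\<in>fst S. snd S (a, b) = Some (inv_into (fst S) \<sigma> (f (\<sigma> a) (\<sigma> b)))))"

definition edit :: "'a set \<Rightarrow> ('a \<Rightarrow> 'a \<Rightarrow> 'a) \<Rightarrow> 'b set \<Rightarrow> ('b \<Rightarrow> 'b \<Rightarrow> 'b) \<Rightarrow> nat" where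
  "edit \<Gamma> f \<Gamma>' g =
     (LEAST d. \<exists>S S'. multiplication_table \<Gamma> f S \<and> multiplication_table \<Gamma>' g S' \<and> d = table_edit S S')"


(* Every finite magma has an isomorphic copy on a set of natural numbers, and both distances
   and binary structures are invariant under isomorphism; so classes of groups, and the
   magmas given to a tester, are taken on sets of natural numbers. *)

type_synonym magma_class = "nat set \<Rightarrow> (nat \<Rightarrow> nat \<Rightarrow> nat) \<Rightarrow> bool"

definition hamming_far :: "magma_class \<Rightarrow> real \<Rightarrow> magma_class" where
  "hamming_far C \<delta> \<Gamma> f \<longleftrightarrow> (\<forall>g. C \<Gamma> g \<longrightarrow> real (Ham \<Gamma> f g) \<ge> \<delta> * (real (card \<Gamma>))\<^sup>2)"

definition edit_far :: "magma_class \<Rightarrow> real \<Rightarrow> magma_class" where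
  "edit_far C \<delta> \<Gamma> f \<longleftrightarrow> (\<forall>\<Gamma>' g. C \<Gamma>' g \<longrightarrow> real (edit \<Gamma> f \<Gamma>' g) \<ge> \<delta> * (real (card \<Gamma>))\<^sup>2)"


definition strings :: "nat \<Rightarrow> bool list set" where
  "strings q = {z. length z = nat \<lceil>log 2 (real q)\<rceil>}"

type_synonym sample_oracle = "bool list pmf"
type_synonym mult_oracle = "bool list \<Rightarrow> bool list \<Rightarrow> bool list"

definition binary_structure ::
    "'a set \<Rightarrow> ('a \<Rightarrow> 'a \<Rightarrow> 'a) \<Rightarrow> nat \<Rightarrow> sample_oracle \<Rightarrow> mult_oracle \<Rightarrow> bool" where
  "binary_structure \<Gamma> f q O1 O2 \<longleftrightarrow> card \<Gamma> \<le> q \<and>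
     (\<exists>\<pi>. inj_on \<pi> \<Gamma> \<and> \<pi> ` \<Gamma> \<subseteq> strings q \<and>
        O1 = map_pmf \<pi> (pmf_of_set \<Gamma>) \<and>
        (\<forall>z1\<in>\<pi> ` \<Gamma>. \<forall>z2\<in>\<pi> ` \<Gamma>. O2 z1 z2 = \<pi> (f (inv_into \<Gamma> \<pi> z1) (inv_into \<Gamma> \<pi> z2))))"


(* Adaptive randomized query algorithms.  Random draws internal randomness and is not a query;
   Sample and Multiply call the first and the second oracle.  Answer True means PASS. *)

datatype algorithm =
    Answer bool
  | Random "nat pmf" "nat \<Rightarrow> algorithm"
  | Sample "bool list \<Rightarrow> algorithm"
  | Multiply "bool list" "bool list" "bool list \<Rightarrow> algorithm"

(* Joint distribution of the answer and the number of queries. *)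

primrec run :: "sample_oracle \<Rightarrow> mult_oracle \<Rightarrow> algorithm \<Rightarrow> (bool \<times> nat) pmf" where
  "run O1 O2 (Answer b) = return_pmf (b, 0)"
| "run O1 O2 (Random p A) = bind_pmf p (\<lambda>i. run O1 O2 (A i))"
| "run O1 O2 (Sample A) = map_pmf (apsnd Suc) (bind_pmf O1 (\<lambda>z. run O1 O2 (A z)))"
| "run O1 O2 (Multiply z1 z2 A) = map_pmf (apsnd Suc) (run O1 O2 (A (O2 z1 z2)))"

(* The algorithm A n q is given both the size n of the magma and the integer q of the binary
   structure.  A tester that does not know the size is the case of A n q independent of n. *)

definition eps_tester ::
    "(magma_class \<Rightarrow> real \<Rightarrow> magma_class) \<Rightarrow> magma_class \<Rightarrow> real \<Rightarrow> (nat \<Rightarrow> nat \<Rightarrow> algorithm) \<Rightarrow> bool" where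
  "eps_tester far C \<epsilon> A \<longleftrightarrow>
     (\<forall>\<Gamma> f q O1 O2. magma \<Gamma> f \<and> binary_structure \<Gamma> f q O1 O2 \<longrightarrow>
        (C \<Gamma> f \<longrightarrow> pmf (map_pmf fst (run O1 O2 (A (card \<Gamma>) q))) True \<ge> 2/3) \<and>
        (far C \<epsilon> \<Gamma> f \<longrightarrow> pmf (map_pmf fst (run O1 O2 (A (card \<Gamma>) q))) False \<ge> 2/3))"

(* Worst case over all binary structures with parameter q for magmas of size n, and over all
   random choices. *)

definition query_complexity :: "(nat \<Rightarrow> nat \<Rightarrow> algorithm) \<Rightarrow> nat \<Rightarrow> nat \<Rightarrow> enat" where
  "query_complexity A n q = Sup {enat c | c. \<exists>(\<Gamma> :: nat set) f O1 O2 b.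
     magma \<Gamma> f \<and> card \<Gamma> = n \<and> binary_structure \<Gamma> f q O1 O2 \<and> (b, c) \<in> set_pmf (run O1 O2 (A n q))}"

(* The query complexity is Omega(n^s) in the size n, whatever q is.  For known sizes this cannot
   be asked of every large n: all groups of prime order are cyclic, and then polylogarithmically
   many queries suffice.  It is asked of some size in every interval [N, C * N] with N large,
   that is, of sizes of every order of magnitude. *)

definition query_complexity_Omega :: "(nat \<Rightarrow> nat \<Rightarrow> algorithm) \<Rightarrow> real \<Rightarrow> bool" where
  "query_complexity_Omega A s \<longleftrightarrow>
     (\<exists>c>0. \<exists>C. \<forall>\<^sub>F N in sequentially. \<exists>n\<in>{N..C * N}. \<forall>q\<ge>n.
        ereal (c * real n powr s) \<le> ereal_of_enat (query_complexity A n q))"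

end

theory Submission
  imports Defs "HOL-Real_Asymp.Real_Asymp"
begin

text \<open>
  Write \<open>H(a, r)\<close> for the product of \<open>a\<close> cyclic groups of order \<open>p\<^sup>2\<close> and \<open>r - a\<close> cyclic groups of
  order \<open>p\<close>, where \<open>p\<close> is prime. The groups \<open>H(a + 1, k)\<close> and \<open>H(a, k + 1)\<close> have the same order
  \<open>n = p ^ (a + k + 1)\<close> and the same exponent. The first is generated by \<open>k\<close> elements. The second has
  \<open>p ^ (k + 1)\<close> elements killed by \<open>p\<close>, so it does not embed into an abelian group generated by \<open>k\<close>
  elements; as an approximate embedding of groups can be corrected to an embedding by a majority
  vote, it is \<open>1/23\<close>-far from all of these in both distances.

  If the elements are labelled at random, an algorithm learns something only when two distinct
  words in the elements seen so far, with coefficients modulo \<open>p\<^sup>2\<close>, take the same value. In either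
  group this has probability at most \<open>p ^ (- a)\<close> for each pair of words. So \<open>T\<close> queries cannot tell
  the groups apart if \<open>T\<^sup>2\<close> is small compared with \<open>p ^ a\<close>. Take \<open>a = k div 2\<close>. Primes \<open>p\<close> of
  every order of magnitude exist by an estimate of Chebyshev type.
\<close>

text \<open>The module of words over the integers modulo p^2 serves both groups, so the simulated
  run is one and the same object for both. Two distinct words differ in some coefficient by a number
  u that p^2 does not divide. Multiplication by u kills at most p elements of each cyclic factor,
  hence at most p^r of the p^(a + r) elements of H(a, r); this is the origin of p^(-a).

  An algorithm can thus make about sqrt (p^a) queries in vain, which in terms of n is n^s with s = a
  / (2 (a + k + 1)). Every a < k is admissible, and a = k div 2 is the choice that reproduces the
  exponents of the theorem.

  If the operations disagree on fewer than n^2 / 23 pairs, the correction changes fewer than 3 n /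
  23 values, and in the edit distance fewer than n / 23 further elements lose their label. More than
  half of the group remains untouched, and a homomorphism that is injective on more than half of a
  finite group is injective.\<close>

section \<open>Primes between powers of two\<close>

text \<open>In Leibniz' harmonic triangle \<open>1 / (j * (n choose j))\<close>, each entry is the difference of two
  earlier ones, so \<open>Lcm {1..n}\<close> clears all denominators.\<close>

lemma mult_binomial_dvd_Lcm:
  fixes n j :: nat
  assumes "j < n"
  shows "Suc j * (n choose Suc j) dvd Lcm {1..n}"
  using assms
proof (induction j arbitrary: n)
  case 0
  then show ?case by (auto intro: dvd_Lcm)
next
  case (Suc j)
  then obtain m where n: "n = Suc m" "Suc j \<le> m" by (cases n) auto
  define L where "L = Lcm {1..n}"
  define A where "A = Suc j * (m choose Suc j)"
  define B where "B = Suc j * (n choose Suc j)"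
  define D where "D = Suc (Suc j) * (n choose Suc (Suc j))"
  have "Lcm {1..m} dvd L" unfolding L_def using n by (intro Lcm_subset) auto
  with Suc.IH[of m] n have "A dvd L" unfolding A_def by (meson Suc_le_eq dvd_trans)
  then obtain a where a: "L = A * a" by (auto simp: dvd_def)
  have "B dvd L" unfolding L_def B_def using Suc by auto
  then obtain b where b: "L = B * b" by (auto simp: dvd_def)
  have D: "D = Suc m * (m choose Suc j)" unfolding D_def n by (rule Suc_times_binomial)
  have B: "B = Suc m * (m choose j)" unfolding B_def n by (rule Suc_times_binomial)
  have "Suc j * D = Suc m * A" unfolding D A_def by (simp only: ac_simps)
  moreover have "A + Suc j * (m choose j) = B" unfolding A_def B_def n by (simp add: algebra_simps)
  then have "Suc m * A + Suc j * B = Suc m * B" unfolding B by algebra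
  \<comment> \<open>The two identities together say 1/D = 1/A - 1/B. With \<open>L = A * a\<close>
    and \<open>L = B * b\<close> this becomes \<open>L = D * (a - b)\<close>; the subtraction is the
    reason for passing to integers.\<close>
  ultimately have "int (Suc j) * D = int (Suc m) * A"
    "int (Suc m) * A + int (Suc j) * B = int (Suc m) * B"
    by (metis of_nat_mult of_nat_add)+
  moreover from this have "int (Suc j) * (int D * (int a - int b)) = int (Suc j) * int L"
    using a b unfolding of_nat_mult by (smt (verit) a b left_diff_distrib mult.assoc mult.commute of_nat_mult right_diff_distrib)
  ultimately have "int L = int D * (int a - int b)" by simp
  then have "int D dvd int L" by simp
  then show ?case unfolding D_def L_def by (simp only: int_dvd_int_iff)
qed

lemma Lcm_atLeastAtMost_lower_bound:
  assumes "m > 0"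
  shows "4 ^ m / (2 * real m) \<le> real (Lcm {1..2 * m})"
proof -
  have "m * ((2 * m) choose m) dvd Lcm {1..2 * m}"
    using mult_binomial_dvd_Lcm[of "m - 1" "2 * m"] assms by simp
  then have "m * ((2 * m) choose m) \<le> Lcm {1..2 * m}"
    by (rule dvd_imp_le) (auto intro!: Nat.gr0I)
  then have "(2 * m) choose m \<le> Lcm {1..2 * m}"
    using assms by (metis One_nat_def Suc_leI le_trans mult_le_mono1 nat_mult_1)
  then show ?thesis
    using central_binomial_lower_bound[OF assms] by (smt (verit) of_nat_mono)
qed

section \<open>Products of primes and upper bounds for \<open>Lcm {1..n}\<close>\<close>

definition primorial :: "nat \<Rightarrow> nat" where
  "primorial x = \<Prod>{p. prime p \<and> p \<le> x}"

lemma finite_primes_le [simp]: "finite {p::nat. prime p \<and> p \<le> x}"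
  by (rule finite_subset[of _ "{..x}"]) auto

lemma prod_primes_dvd:
  fixes x :: nat
  assumes "finite A" "\<And>p. p \<in> A \<Longrightarrow> prime p \<and> p dvd x"
  shows "\<Prod>A dvd x"
  using assms
proof (induction A rule: finite_induct)
  case (insert p A)
  have "coprime p (\<Prod>A)"
    by (rule prod_coprime_right) (use insert in \<open>metis insertI1 insertI2 primes_coprime\<close>)
  with insert show ?case by (auto intro: divides_mult)
qed simp

text \<open>A prime in (m, 2m] divides (2m)! but not m!, so it divides the central binomial
  coefficient, which is at most 4^m.\<close>

lemma primorial_double_le: "primorial (2 * m) \<le> primorial m * 4 ^ m"
proof -
  let ?Q = "{p::nat. prime p \<and> m < p \<and> p \<le> 2 * m}"
  have fin: "finite ?Q" by (rule finite_subset[of _ "{..2*m}"]) auto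
  have "\<Prod>?Q dvd (2 * m) choose m"
  proof (rule prod_primes_dvd[OF fin])
    fix p assume "p \<in> ?Q"
    then have p: "prime p" "m < p" "p \<le> 2 * m" by auto
    have "p dvd fact m * fact m * ((2 * m) choose m)"
      using binomial_fact_lemma[of m "2 * m"] p prime_dvd_fact_iff[of p "2 * m"] by (simp add: mult_2)
    then show "prime p \<and> p dvd ((2 * m) choose m)"
      using p by (auto simp: prime_dvd_mult_iff prime_dvd_fact_iff)
  qed
  then have "\<Prod>?Q \<le> (2 * m) choose m" by (rule dvd_imp_le) simp
  also have "\<dots> \<le> 2 ^ (2 * m)" by (rule binomial_le_pow2)
  finally have Q: "\<Prod>?Q \<le> 4 ^ m" by (simp add: power_mult)
  have "{p. prime p \<and> p \<le> 2 * m} = {p. prime p \<and> p \<le> m} \<union> ?Q" by auto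
  then have "primorial (2 * m) = primorial m * \<Prod>?Q"
    unfolding primorial_def using fin by (subst prod.union_disjoint[symmetric]) auto
  then show ?thesis using Q by simp
qed

lemma primorial_pow2_le: "primorial (2 ^ j) \<le> 4 ^ (2 ^ j)"
proof (induction j)
  case 0
  have "{p::nat. prime p \<and> p \<le> 1} = {}" by (auto dest: prime_gt_1_nat)
  then have "primorial 1 = 1" unfolding primorial_def by (simp only: prod.empty)
  then show ?case by simp
next
  case (Suc j)
  have "primorial (2 ^ Suc j) \<le> primorial (2 ^ j) * 4 ^ (2 ^ j)"
    using primorial_double_le[of "2 ^ j"] by simp
  also have "\<dots> \<le> 4 ^ (2 ^ j) * 4 ^ (2 ^ j)" using Suc by simp
  also have "\<dots> = 4 ^ (2 ^ Suc j)" by (simp add: mult_2 power_add)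
  finally show ?case .
qed

lemma prime_power_dvd_Lcm:
  fixes p :: nat
  assumes "finite A" "prime p" "0 \<notin> A" "0 < a" "p ^ a dvd Lcm A"
  shows "\<exists>x\<in>A. p ^ a dvd x"
  using assms(1,3,5)
proof (induction A rule: finite_induct)
  case empty
  then show ?case using assms(2,4) by (auto simp: prime_nat_iff)
next
  case (insert x A)
  then have "Lcm A \<noteq> 0" "x \<noteq> 0" by (auto)
  with insert have "a \<le> max (multiplicity p x) (multiplicity p (Lcm A))"
    using assms(2) by (simp add: power_dvd_iff_le_multiplicity multiplicity_lcm prime_nat_iff)
  then have "p ^ a dvd x \<or> p ^ a dvd Lcm A"
    using \<open>Lcm A \<noteq> 0\<close> \<open>x \<noteq> 0\<close> by (auto intro: multiplicity_dvd' simp: le_max_iff_disj)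
  then show ?case using insert by auto
qed

text \<open>A prime power dividing the lcm divides some number up to n, so it is at most n. At most
  sqrt n primes satisfy p^2 <= n, and each contributes at most n. All other primes occur to the
  first power, and their product divides \<open>primorial M\<close>.\<close>

lemma Lcm_atLeastAtMost_upper_bound:
  fixes n M :: nat
  assumes "\<And>p. prime p \<Longrightarrow> p \<le> n \<Longrightarrow> p \<le> M" and "n > 0"
  shows "real (Lcm {1..n}) \<le> real n powr sqrt (real n) * real (primorial M)"
proof -
  define L where "L = Lcm {1..n}"
  have "L \<noteq> 0" unfolding L_def by (auto)
  have pp: "p ^ multiplicity p L \<le> n" if "p \<in> prime_factors L" for p
  proof -
    have "prime p" "p dvd L" using that by auto
    then have "0 < multiplicity p L" using \<open>L \<noteq> 0\<close> by (simp add: prime_multiplicity_gt_zero_iff prime_imp_prime_elem)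
    then have "\<exists>x\<in>{1..n}. p ^ multiplicity p L dvd x"
      using \<open>prime p\<close> by (intro prime_power_dvd_Lcm) (auto simp: L_def[symmetric] multiplicity_dvd simp del: One_nat_def)
    then obtain x where x: "x \<in> {1..n}" "p ^ multiplicity p L dvd x" by blast
    from dvd_imp_le[OF x(2)] x(1) show ?thesis by simp
  qed
  define S where "S = {p \<in> prime_factors L. p * p \<le> n}"
  define B where "B = {p \<in> prime_factors L. \<not> p * p \<le> n}"
  have fin: "finite S" "finite B" unfolding S_def B_def by auto
  have m1: "p ^ multiplicity p L = p" if "p \<in> B" for p
  proof -
    have p: "p \<in> prime_factors L" "\<not> p * p \<le> n" "prime p" using that unfolding B_def by auto
    have "multiplicity p L \<noteq> 0"
      using p \<open>L \<noteq> 0\<close> by (simp add: prime_factors_multiplicity)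
    moreover have "\<not> multiplicity p L \<ge> 2"
    proof
      assume "multiplicity p L \<ge> 2"
      then have "p ^ 2 \<le> p ^ multiplicity p L" using p(3) by (intro power_increasing) (auto simp: prime_nat_iff)
      with pp[OF p(1)] p(2) show False by (simp add: power2_eq_square)
    qed
    ultimately have "multiplicity p L = 1" by simp
    then show ?thesis by simp
  qed
  have "L = (\<Prod>p\<in>prime_factors L. p ^ multiplicity p L)"
    using \<open>L \<noteq> 0\<close> by (metis normalize_nat_def id_apply prod_prime_factors)
  also have "prime_factors L = S \<union> B" unfolding S_def B_def by auto
  also have "(\<Prod>p\<in>S \<union> B. p ^ multiplicity p L) = (\<Prod>p\<in>S. p ^ multiplicity p L) * (\<Prod>p\<in>B. p ^ multiplicity p L)"
    using fin by (intro prod.union_disjoint) (auto simp: S_def B_def)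
  also have "\<dots> \<le> n ^ card S * primorial M"
  proof (rule mult_le_mono)
    show "(\<Prod>p\<in>S. p ^ multiplicity p L) \<le> n ^ card S"
      using pp prod_mono[of S "\<lambda>p. p ^ multiplicity p L" "\<lambda>_. n"] by (simp add: S_def)
    have "(\<Prod>p\<in>B. p ^ multiplicity p L) = \<Prod>B" using m1 by simp
    also have "\<dots> dvd primorial M" unfolding primorial_def
    proof (rule prod_dvd_prod_subset, simp, safe)
      fix p assume "p \<in> B"
      then have p: "p \<in> prime_factors L" unfolding B_def by auto
      then show "prime p" by auto
      moreover have "p \<le> n" using pp[OF p] m1[OF \<open>p \<in> B\<close>] by simp
      ultimately show "p \<le> M" using assms by auto
    qed
    finally show "(\<Prod>p\<in>B. p ^ multiplicity p L) \<le> primorial M"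
      by (rule dvd_imp_le) (auto simp: primorial_def prime_gt_0_nat)
  qed
  finally have "real L \<le> real n ^ card S * real (primorial M)"
    by (metis of_nat_le_iff of_nat_mult of_nat_power)
  moreover have "real n ^ card S \<le> real n powr sqrt (real n)"
  proof -
    have "S \<subseteq> {1..nat \<lfloor>sqrt (real n)\<rfloor>}"
    proof
      fix p assume "p \<in> S"
      then have "prime p" "p * p \<le> n" unfolding S_def by auto
      then have "real p * real p \<le> real n" by (metis of_nat_le_iff of_nat_mult)
      then have "real p \<le> sqrt (real n)" by (simp add: real_le_rsqrt power2_eq_square)
      then show "p \<in> {1..nat \<lfloor>sqrt (real n)\<rfloor>}" using \<open>prime p\<close> by (auto simp: le_nat_floor Suc_leI prime_gt_0_nat)
    qed
    from card_mono[OF _ this] have "card S \<le> nat \<lfloor>sqrt (real n)\<rfloor>" by simp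
    then have "real (card S) \<le> sqrt (real n)" by (simp add: le_nat_iff le_floor_iff)
    then show ?thesis using \<open>n > 0\<close> by (simp add: powr_realpow[symmetric] powr_mono)
  qed
  ultimately show ?thesis unfolding L_def
    by (smt (verit) mult_right_mono of_nat_0_le_iff)
qed

text \<open>Put x = 2^j. Without such a prime, the lcm of {1..4x} would be at most (4x)^(sqrt (4x))
  * 4^x, while it is at least 4^(2x) / (4x). The window has ratio 4 because for ratio 2 both bounds
  have the main term 4^x and do not conflict.\<close>

lemma eventually_prime_between_pow2:
  "\<forall>\<^sub>F j in sequentially. \<exists>p::nat. prime p \<and> 2 ^ j < p \<and> p \<le> 4 * 2 ^ j"
proof -
  have "\<forall>\<^sub>F x::real in at_top. sqrt (4 * x) * ln (4 * x) + ln (4 * x) + x * ln 4 < 2 * x * ln 4"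
    by real_asymp
  then have "\<forall>\<^sub>F x::real in at_top. (4 * x) powr sqrt (4 * x) * 4 powr x < 4 powr (2 * x) / (4 * x)"
    using eventually_gt_at_top[of 0]
  proof eventually_elim
    case (elim x)
    have "(4 * x) powr sqrt (4 * x) * 4 powr x * (4 * x)
        = exp (sqrt (4 * x) * ln (4 * x) + ln (4 * x) + x * ln 4)"
      using elim by (simp add: powr_def exp_add)
    also have "\<dots> < exp (2 * x * ln 4)" using elim by simp
    also have "\<dots> = 4 powr (2 * x)" by (simp add: powr_def)
    finally show ?case using elim by (simp add: pos_less_divide_eq)
  qed
  moreover have "filterlim (\<lambda>j::nat. (2::real) ^ j) at_top sequentially" by real_asymp
  ultimately have "\<forall>\<^sub>F j in sequentially. (4 * 2 ^ j) powr sqrt (4 * 2 ^ j) * 4 powr (2 ^ j :: real) < 4 powr (2 * 2 ^ j) / (4 * 2 ^ j)"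
    by (rule eventually_compose_filterlim)
  then show ?thesis
  proof eventually_elim
    case (elim j)
    show ?case
    proof (rule ccontr)
      assume "\<nexists>p. prime p \<and> 2 ^ j < p \<and> p \<le> 4 * (2::nat) ^ j"
      then have no: "\<And>p::nat. prime p \<Longrightarrow> p \<le> 4 * 2 ^ j \<Longrightarrow> p \<le> 2 ^ j" by (meson not_le)
      have "4 ^ (2 * 2 ^ j) / (2 * real (2 * 2 ^ j)) \<le> real (Lcm {1..2 * (2 * 2 ^ j)})"
        by (rule Lcm_atLeastAtMost_lower_bound) simp
      also have "\<dots> = real (Lcm {1..4 * 2 ^ j})" by simp
      also have "\<dots> \<le> real (4 * 2 ^ j) powr sqrt (real (4 * 2 ^ j)) * real (primorial (2 ^ j))"
        using no by (intro Lcm_atLeastAtMost_upper_bound) auto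
      also have "\<dots> \<le> real (4 * 2 ^ j) powr sqrt (real (4 * 2 ^ j)) * real (4 ^ (2 ^ j))"
        by (intro mult_left_mono of_nat_mono primorial_pow2_le) simp
      finally have *: "4 ^ (2 * 2 ^ j) / (2 * real (2 * 2 ^ j)) \<le> real (4 * 2 ^ j) powr sqrt (real (4 * 2 ^ j)) * real (4 ^ (2 ^ j))" .
      have e: "(4::real) powr (2 ^ j) = 4 ^ (2 ^ j)" "(4::real) powr (2 * 2 ^ j) = 4 ^ (2 * 2 ^ j)"
        using powr_realpow[of 4 "2 ^ j"] powr_realpow[of 4 "2 * 2 ^ j"] by simp_all
      show False using * elim unfolding e by simp
    qed
  qed
qed

section \<open>Approximate homomorphisms\<close>

lemma (in group) mult_inv_cancel_middle:
  assumes "a \<in> carrier G" "b \<in> carrier G" "c \<in> carrier G"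
  shows "(a \<otimes> inv b) \<otimes> (b \<otimes> inv c) = a \<otimes> inv c"
  using assms by (metis inv_closed l_inv l_one m_assoc m_closed)

lemma (in group) mult_inv_cancel_right:
  assumes "a \<in> carrier G" "b \<in> carrier G" "u \<in> carrier G"
  shows "(a \<otimes> u) \<otimes> inv (b \<otimes> u) = a \<otimes> inv b"
  using assms by (metis inv_closed inv_mult_group l_one m_assoc m_closed r_inv)

text \<open>The number of pairs with equal values is the sum over y of the size of its value class,
  so it is at most \<open>card A\<close> times the largest class. A high collision rate therefore
  forces a dominant value.\<close>

lemma exists_majority_value:
  fixes h :: "'a \<Rightarrow> 'b"
  assumes "finite A" "A \<noteq> {}"
  shows "\<exists>c. card {(y, z) \<in> A \<times> A. h y = h z} \<le> card A * card {y \<in> A. h y = c}"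
proof -
  define F where "F = (\<lambda>y. card {z \<in> A. h z = h y})"
  obtain y0 where y0: "y0 \<in> A" "\<And>y. y \<in> A \<Longrightarrow> F y \<le> F y0"
  proof -
    have "finite (F ` A)" "F ` A \<noteq> {}" using assms by auto
    then have "Max (F ` A) \<in> F ` A" by (rule Max_in)
    then obtain y0 where "y0 \<in> A" "F y0 = Max (F ` A)" by auto
    with assms that show ?thesis by (metis Max_ge \<open>finite (F ` A)\<close> imageI)
  qed
  have "{(y, z) \<in> A \<times> A. h y = h z} = Sigma A (\<lambda>y. {z \<in> A. h z = h y})" by auto
  then have "card {(y, z) \<in> A \<times> A. h y = h z} = (\<Sum>y\<in>A. F y)"
    using assms by (simp add: F_def card_SigmaI)
  also have "\<dots> \<le> (\<Sum>y\<in>A. F y0)" using y0 by (intro sum_mono) auto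
  finally show ?thesis by (intro exI[of _ "h y0"]) (simp add: F_def)
qed

text \<open>Self-correction: the homomorphism sends \<open>x\<close> to the most frequent value of
  \<open>\<phi> (x y) (\<phi> y)\<^sup>-\<^sup>1\<close>.\<close>

lemma approximate_hom_correction:
  fixes G :: "('a, 'c) monoid_scheme" and H :: "('b, 'd) monoid_scheme"
  assumes G: "group G" and H: "group H" and fin: "finite (carrier G)"
    and \<phi>: "\<phi> \<in> carrier G \<rightarrow> carrier H"
    and bad: "23 * card {(x, y) \<in> carrier G \<times> carrier G. \<phi> (x \<otimes>\<^bsub>G\<^esub> y) \<noteq> \<phi> x \<otimes>\<^bsub>H\<^esub> \<phi> y} < (card (carrier G))\<^sup>2"
  shows "\<exists>\<psi>\<in>hom G H. 23 * card {x \<in> carrier G. \<phi> x \<noteq> \<psi> x} < 3 * card (carrier G)"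
proof -
  interpret G: group G by fact
  interpret H: group H by fact
  let ?G = "carrier G"
  define n where "n = card ?G"
  have "n > 0" unfolding n_def using fin G.one_closed card_gt_0_iff by blast
  define B where "B = {(x, y) \<in> ?G \<times> ?G. \<phi> (x \<otimes>\<^bsub>G\<^esub> y) \<noteq> \<phi> x \<otimes>\<^bsub>H\<^esub> \<phi> y}"
  have finB: "finite B" unfolding B_def using fin by (auto intro: finite_subset[of _ "?G \<times> ?G"])
  have B: "23 * card B < n * n" using bad unfolding B_def n_def power2_eq_square .
  have good: "\<phi> (x \<otimes>\<^bsub>G\<^esub> y) = \<phi> x \<otimes>\<^bsub>H\<^esub> \<phi> y" if "x \<in> ?G" "y \<in> ?G" "(x, y) \<notin> B" for x y
    using that unfolding B_def by auto
  have \<phi>c [simp]: "\<phi> x \<in> carrier H" if "x \<in> ?G" for x using \<phi> that by auto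
  define h where "h = (\<lambda>x y. \<phi> (x \<otimes>\<^bsub>G\<^esub> y) \<otimes>\<^bsub>H\<^esub> inv\<^bsub>H\<^esub> \<phi> y)"
  have h_closed: "h x y \<in> carrier H" if "x \<in> ?G" "y \<in> ?G" for x y
    unfolding h_def using that by simp
  \<comment> \<open>Write z = y u. If \<open>\<phi>\<close> is multiplicative on (y, u) and on (x y,
    u), then the factor \<open>\<phi> u\<close> cancels and \<open>h x y = h x z\<close>. Each
    condition fails for at most \<open>card B\<close> pairs, whence the factor 2.\<close>
  have maj: "\<exists>c. 23 * card {y \<in> ?G. h x y \<noteq> c} < 2 * n" if x: "x \<in> ?G" for x
  proof -
    let ?E = "{(y, z) \<in> ?G \<times> ?G. h x y = h x z}"
    let ?D = "{(y, z) \<in> ?G \<times> ?G. h x y \<noteq> h x z}"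
    obtain c where c: "card ?E \<le> n * card {y \<in> ?G. h x y = c}"
      using exists_majority_value[OF fin, of "h x"] G.one_closed unfolding n_def by blast
    have "?D \<subseteq> (\<lambda>(y, u). (y, y \<otimes>\<^bsub>G\<^esub> u)) ` B \<union> (\<lambda>(w, u). (inv\<^bsub>G\<^esub> x \<otimes>\<^bsub>G\<^esub> w, inv\<^bsub>G\<^esub> x \<otimes>\<^bsub>G\<^esub> w \<otimes>\<^bsub>G\<^esub> u)) ` B" (is "_ \<subseteq> ?I1 \<union> ?I2")
    proof (safe, rule ccontr)
      fix y z assume yz: "y \<in> ?G" "z \<in> ?G" and ne: "h x y \<noteq> h x z"
        and n2: "(y, z) \<notin> ?I2" and n1: "(y, z) \<notin> ?I1"
      define u where "u = inv\<^bsub>G\<^esub> y \<otimes>\<^bsub>G\<^esub> z"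
      have u: "u \<in> ?G" "z = y \<otimes>\<^bsub>G\<^esub> u" using yz unfolding u_def by (auto simp: G.m_assoc[symmetric])
      have "(y, u) \<notin> B" using n1 u by (auto simp: image_iff)
      moreover have "(x \<otimes>\<^bsub>G\<^esub> y, u) \<notin> B"
      proof
        assume "(x \<otimes>\<^bsub>G\<^esub> y, u) \<in> B"
        then have "(inv\<^bsub>G\<^esub> x \<otimes>\<^bsub>G\<^esub> (x \<otimes>\<^bsub>G\<^esub> y), inv\<^bsub>G\<^esub> x \<otimes>\<^bsub>G\<^esub> (x \<otimes>\<^bsub>G\<^esub> y) \<otimes>\<^bsub>G\<^esub> u) \<in> ?I2" by force
        moreover have "inv\<^bsub>G\<^esub> x \<otimes>\<^bsub>G\<^esub> (x \<otimes>\<^bsub>G\<^esub> y) = y" using x yz by (simp add: G.m_assoc[symmetric])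
        ultimately show False using n2 u by simp
      qed
      ultimately have "\<phi> z = \<phi> y \<otimes>\<^bsub>H\<^esub> \<phi> u" "\<phi> (x \<otimes>\<^bsub>G\<^esub> z) = \<phi> (x \<otimes>\<^bsub>G\<^esub> y) \<otimes>\<^bsub>H\<^esub> \<phi> u"
        using good[of y u] good[of "x \<otimes>\<^bsub>G\<^esub> y" u] x yz u by (auto simp: G.m_assoc)
      then have "h x z = h x y" unfolding h_def using x yz u
        by (simp add: H.mult_inv_cancel_right)
      with ne show False by simp
    qed
    then have "card ?D \<le> card (?I1 \<union> ?I2)" using finB by (intro card_mono) auto
    also have "\<dots> \<le> card B + card B"
      by (rule order.trans[OF card_Un_le add_mono]) (auto intro: card_image_le finB)
    finally have D: "card ?D \<le> 2 * card B" by simp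
    have "?G \<times> ?G = ?E \<union> ?D" by auto
    moreover have "card (?E \<union> ?D) = card ?E + card ?D"
      by (rule card_Un_disjoint) (auto intro: finite_subset[of _ "?G \<times> ?G"] fin)
    ultimately have ED: "card ?E + card ?D = n * n" by (metis card_cartesian_product n_def)
    have "card {y \<in> ?G. h x y = c} + card {y \<in> ?G. h x y \<noteq> c} = n"
      unfolding n_def using fin by (subst card_Un_disjoint[symmetric]) (auto intro: arg_cong[where f = card])
    then have "n * card {y \<in> ?G. h x y = c} + n * card {y \<in> ?G. h x y \<noteq> c} = n * n"
      by (metis distrib_left)
    then have "23 * (n * card {y \<in> ?G. h x y \<noteq> c}) < 2 * (n * n)" using c D ED B by linarith
    then have "n * (23 * card {y \<in> ?G. h x y \<noteq> c}) < n * (2 * n)" by (simp add: algebra_simps)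
    then show ?thesis by auto
  qed
  then obtain \<psi> where \<psi>: "\<And>x. x \<in> ?G \<Longrightarrow> 23 * card {y \<in> ?G. h x y \<noteq> \<psi> x} < 2 * n" by metis
  have ex: "\<exists>z\<in>?G. z \<notin> A" if "23 * card A < 23 * n" "finite A" for A
  proof (rule ccontr)
    assume "\<not> ?thesis"
    then have "?G \<subseteq> A" by auto
    from card_mono[OF that(2) this] that(1) show False unfolding n_def by simp
  qed
  let ?W = "\<lambda>x. {y \<in> ?G. h x y \<noteq> \<psi> x}"
  have finW: "finite (?W x)" for x using fin by simp
  have \<psi>c: "\<psi> x \<in> carrier H" if x: "x \<in> ?G" for x
  proof -
    obtain z where "z \<in> ?G" "z \<notin> ?W x" using ex[of "?W x"] \<psi>[OF x] finW by force
    then show ?thesis using h_closed[OF x] by force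
  qed
  \<comment> \<open>The identity h(x, y z) h(y, z) = h(x y, z) gives the claim at any z where all
    three values are the majority ones. Each fails on fewer than 2 n / 23 elements, so fewer than 6
    n / 23 choices of z are excluded.\<close>
  have \<psi>hom: "\<psi> (x \<otimes>\<^bsub>G\<^esub> y) = \<psi> x \<otimes>\<^bsub>H\<^esub> \<psi> y" if xy: "x \<in> ?G" "y \<in> ?G" for x y
  proof -
    let ?V = "(\<lambda>w. inv\<^bsub>G\<^esub> y \<otimes>\<^bsub>G\<^esub> w) ` ?W x"
    have "card (?V \<union> ?W y \<union> ?W (x \<otimes>\<^bsub>G\<^esub> y)) \<le> card (?W x) + card (?W y) + card (?W (x \<otimes>\<^bsub>G\<^esub> y))"
      by (intro order.trans[OF card_Un_le] add_mono card_image_le finW order_refl)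
    then have "23 * card (?V \<union> ?W y \<union> ?W (x \<otimes>\<^bsub>G\<^esub> y)) < 23 * n"
      using \<psi>[OF xy(1)] \<psi>[OF xy(2)] \<psi>[OF G.m_closed[OF xy]] by linarith
    then obtain z where z: "z \<in> ?G" "z \<notin> ?V" "z \<notin> ?W y" "z \<notin> ?W (x \<otimes>\<^bsub>G\<^esub> y)"
      using ex[of "?V \<union> ?W y \<union> ?W (x \<otimes>\<^bsub>G\<^esub> y)"] finW by auto
    have "y \<otimes>\<^bsub>G\<^esub> z \<notin> ?W x"
    proof
      assume "y \<otimes>\<^bsub>G\<^esub> z \<in> ?W x"
      then have "inv\<^bsub>G\<^esub> y \<otimes>\<^bsub>G\<^esub> (y \<otimes>\<^bsub>G\<^esub> z) \<in> ?V" by (rule imageI)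
      with z xy show False by (simp add: G.m_assoc[symmetric])
    qed
    then have "h x (y \<otimes>\<^bsub>G\<^esub> z) = \<psi> x" "h y z = \<psi> y" "h (x \<otimes>\<^bsub>G\<^esub> y) z = \<psi> (x \<otimes>\<^bsub>G\<^esub> y)"
      using z xy by auto
    moreover have "h x (y \<otimes>\<^bsub>G\<^esub> z) \<otimes>\<^bsub>H\<^esub> h y z = h (x \<otimes>\<^bsub>G\<^esub> y) z"
      unfolding h_def using xy z H.mult_inv_cancel_middle by (simp add: G.m_assoc)
    ultimately show ?thesis by simp
  qed
  \<comment> \<open>If \<open>\<phi> x\<close> is not the majority value, then for every y either
    (x, y) is in \<open>B\<close> or \<open>h x y\<close> misses the majority value. The two kinds
    of pairs account for 1 and 2 of the resulting 3 n^2 / 23.\<close>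
  have "card {x \<in> ?G. \<phi> x \<noteq> \<psi> x} * n \<le> card (B \<union> Sigma ?G ?W)"
  proof -
    have "{x \<in> ?G. \<phi> x \<noteq> \<psi> x} \<times> ?G \<subseteq> B \<union> Sigma ?G ?W"
    proof (safe, rule ccontr)
      fix x y assume xy: "x \<in> ?G" "y \<in> ?G" and ne: "\<phi> x \<noteq> \<psi> x" and *: "h x y = \<psi> x" "(x, y) \<notin> B"
      have "h x y = \<phi> x" unfolding h_def using good[of x y] xy * by (simp add: H.m_assoc)
      with * ne show False by simp
    qed
    moreover have "finite (B \<union> Sigma ?G ?W)" using finB fin by auto
    ultimately have "card ({x \<in> ?G. \<phi> x \<noteq> \<psi> x} \<times> ?G) \<le> card (B \<union> Sigma ?G ?W)" by (rule card_mono[rotated])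
    then show ?thesis by (simp add: card_cartesian_product n_def)
  qed
  also have "\<dots> \<le> card B + card (Sigma ?G ?W)" by (rule card_Un_le)
  also have "card (Sigma ?G ?W) = (\<Sum>x\<in>?G. card (?W x))" using fin by simp
  finally have le: "card {x \<in> ?G. \<phi> x \<noteq> \<psi> x} * n \<le> card B + (\<Sum>x\<in>?G. card (?W x))" .
  have "(\<Sum>x\<in>?G. 23 * card (?W x)) \<le> (\<Sum>x\<in>?G. 2 * n)" using \<psi> by (intro sum_mono) (simp add: less_imp_le)
  then have "23 * (\<Sum>x\<in>?G. card (?W x)) \<le> 2 * (n * n)" by (simp add: n_def sum_distrib_left)
  with le B have "23 * (card {x \<in> ?G. \<phi> x \<noteq> \<psi> x} * n) < 3 * (n * n)" by linarith
  then have "(23 * card {x \<in> ?G. \<phi> x \<noteq> \<psi> x}) * n < (3 * n) * n" by (simp only: ac_simps)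
  then have "23 * card {x \<in> ?G. \<phi> x \<noteq> \<psi> x} < 3 * n" by simp
  moreover have "\<psi> \<in> hom G H" using \<psi>c \<psi>hom by (auto simp: hom_def)
  ultimately show ?thesis unfolding n_def by blast
qed

text \<open>For c in the kernel, S and its translate S c each fill more than half of the group and
  therefore meet. This gives y and y c in S with equal images, so c is trivial.\<close>

lemma hom_inj_on_if_inj_on_majority:
  assumes G: "group G" and H: "group H" and fin: "finite (carrier G)" and \<psi>: "\<psi> \<in> hom G H"
    and S: "S \<subseteq> carrier G" "inj_on \<psi> S" "card (carrier G) < 2 * card S"
  shows "inj_on \<psi> (carrier G)"
proof -
  interpret G: group G by fact
  interpret H: group H by fact
  interpret hom: group_hom G H \<psi> using \<psi> by (unfold_locales)
  have "c = \<one>\<^bsub>G\<^esub>" if c: "c \<in> carrier G" "\<psi> c = \<one>\<^bsub>H\<^esub>" for c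
  proof -
    let ?S' = "(\<lambda>x. x \<otimes>\<^bsub>G\<^esub> c) ` S"
    have "card ?S' = card S" using c S(1) by (intro card_image inj_onI) (metis G.right_cancel subsetD)
    moreover have "?S' \<subseteq> carrier G" using c S(1) by auto
    ultimately have "S \<inter> ?S' \<noteq> {}" using S(1,3) fin card_Un_disjoint[of S ?S'] card_mono[OF fin, of "S \<union> ?S'"]
      by (metis Un_least finite_subset leD mult_2)
    then obtain y where y: "y \<in> S" "y \<otimes>\<^bsub>G\<^esub> c \<in> S" by auto
    have "\<psi> (y \<otimes>\<^bsub>G\<^esub> c) = \<psi> y" using y c S(1) by auto
    then have "y \<otimes>\<^bsub>G\<^esub> c = y" using S(2) y by (auto dest: inj_onD)
    then show ?thesis using y S(1) c by auto
  qed
  then show ?thesis unfolding hom.inj_on_one_iff by auto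
qed

text \<open>\<open>K\<close> collects the elements with a meaningful image; for the edit distance
  some labels may be missing from the second table. All pairs with first entry outside
  \<open>K\<close> lie in \<open>B\<close>, so fewer than n / 23 elements are outside
  \<open>K\<close>. Together with the fewer than 3 n / 23 corrected values, more than half of the
  group is left on which the homomorphism agrees with the injective part of
  \<open>\<phi>\<close>.\<close>

lemma approximate_embedding_correction:
  assumes G: "group G" and H: "group H" and fin: "finite (carrier G)"
    and \<phi>: "\<phi> \<in> carrier G \<rightarrow> carrier H" and K: "K \<subseteq> carrier G" "inj_on \<phi> K"
    and good: "\<And>x y. x \<in> carrier G \<Longrightarrow> y \<in> carrier G \<Longrightarrow> (x, y) \<notin> B \<Longrightarrow>
        x \<in> K \<and> \<phi> (x \<otimes>\<^bsub>G\<^esub> y) = \<phi> x \<otimes>\<^bsub>H\<^esub> \<phi> y"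
    and B: "finite B" "23 * card B < (card (carrier G))\<^sup>2"
  shows "\<exists>\<psi>\<in>hom G H. inj_on \<psi> (carrier G)"
proof -
  interpret G: group G by fact
  define n where "n = card (carrier G)"
  have "{(x, y) \<in> carrier G \<times> carrier G. \<phi> (x \<otimes>\<^bsub>G\<^esub> y) \<noteq> \<phi> x \<otimes>\<^bsub>H\<^esub> \<phi> y} \<subseteq> B"
    using good by blast
  from card_mono[OF B(1) this] B(2)
  have "23 * card {(x, y) \<in> carrier G \<times> carrier G. \<phi> (x \<otimes>\<^bsub>G\<^esub> y) \<noteq> \<phi> x \<otimes>\<^bsub>H\<^esub> \<phi> y} < (card (carrier G))\<^sup>2"
    by linarith
  from approximate_hom_correction[OF G H fin \<phi> this]
  obtain \<psi> where \<psi>: "\<psi> \<in> hom G H" "23 * card {x \<in> carrier G. \<phi> x \<noteq> \<psi> x} < 3 * n"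
    unfolding n_def by blast
  have "(carrier G - K) \<times> carrier G \<subseteq> B" using good by blast
  from card_mono[OF B(1) this] have "card (carrier G - K) * n \<le> card B"
    by (simp add: card_cartesian_product n_def)
  moreover have "23 * card B < n * n" using B(2) unfolding n_def power2_eq_square .
  ultimately have "23 * card (carrier G - K) * n < n * n" by linarith
  then have cK: "23 * card (carrier G - K) < n" by simp
  define S where "S = {x \<in> K. \<phi> x = \<psi> x}"
  have "carrier G \<subseteq> S \<union> (carrier G - K) \<union> {x \<in> carrier G. \<phi> x \<noteq> \<psi> x}" unfolding S_def by auto
  moreover have "S \<subseteq> carrier G" unfolding S_def using K by auto
  then have "finite (S \<union> (carrier G - K) \<union> {x \<in> carrier G. \<phi> x \<noteq> \<psi> x})" using fin by (auto intro: finite_subset)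
  ultimately have "n \<le> card (S \<union> (carrier G - K) \<union> {x \<in> carrier G. \<phi> x \<noteq> \<psi> x})" unfolding n_def by (intro card_mono)
  also have "\<dots> \<le> card S + card (carrier G - K) + card {x \<in> carrier G. \<phi> x \<noteq> \<psi> x}"
    by (intro order.trans[OF card_Un_le] add_mono order_refl card_Un_le)
  finally have "n < 2 * card S" using cK \<psi>(2) by linarith
  moreover have "inj_on \<psi> S" using K(2) unfolding S_def inj_on_def by auto
  ultimately show ?thesis
    using hom_inj_on_if_inj_on_majority[OF G H fin \<psi>(1) \<open>S \<subseteq> carrier G\<close>] \<psi>(1) unfolding n_def by blast
qed

section \<open>Edit distance\<close>

text \<open>With missing entries read as \<open>None\<close>, an operation changes at most as many
  values as it costs: 2 k + 1 and 2 k - 1 are the sizes of the borders (one row and one column) that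
  insertion adds and deletion removes.\<close>

lemma edit_step_is_table_and_cost:
  assumes "edit_step S d S'" "is_table S"
  shows "is_table S' \<and> card {ab. snd S ab \<noteq> snd S' ab} \<le> d"
  using assms
proof cases
  case (exchange a P b T v)
  have "{ab. T ab \<noteq> (T((a, b) \<mapsto> v)) ab} \<subseteq> {(a, b)}" by auto
  from card_mono[OF _ this] have "card {ab. T ab \<noteq> (T((a, b) \<mapsto> v)) ab} \<le> 1" by simp
  moreover have "is_table S'" using exchange assms(2) unfolding is_table_def by auto
  ultimately show ?thesis using exchange by simp
next
  case (insert a P T' T)
  have fin: "finite P" using insert(1) assms(2) unfolding is_table_def by simp
  have "T ab = T' ab" if "ab \<in> P \<times> P" for ab
    using that insert(6) by (metis restrict_in)
  moreover have "T ab = T' ab" if "ab \<notin> insert a P \<times> insert a P" for ab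
    using that insert(5,6) by (metis domIff restrict_map_def)
  ultimately have "{ab. T ab \<noteq> T' ab} \<subseteq> insert a P \<times> insert a P - P \<times> P" by blast
  from card_mono[OF _ this] have "card {ab. T ab \<noteq> T' ab} \<le> card (insert a P \<times> insert a P - P \<times> P)"
    using fin by simp
  also have "\<dots> = card (insert a P) * card (insert a P) - card P * card P"
    using fin card_Diff_subset[of "P \<times> P" "insert a P \<times> insert a P"]
    by (metis Sigma_mono card_cartesian_product finite_cartesian_product subset_insertI)
  also have "\<dots> = 2 * card P + 1" using fin insert(4) by simp
  finally show ?thesis using insert(1-3,5) fin unfolding is_table_def by simp
next
  case (delete a P T)
  have fin: "finite P" "dom T = P \<times> P" using delete(1) assms(2) unfolding is_table_def by simp_all
  let ?Q = "P - {a}"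
  have "{ab. T ab \<noteq> (T |` (?Q \<times> ?Q)) ab} \<subseteq> P \<times> P - ?Q \<times> ?Q"
    using fin(2) by (auto simp: restrict_map_def split: if_splits)
  from card_mono[OF _ this] have "card {ab. T ab \<noteq> (T |` (?Q \<times> ?Q)) ab} \<le> card (P \<times> P - ?Q \<times> ?Q)"
    using fin by simp
  also have "\<dots> = card P * card P - card ?Q * card ?Q"
    using fin card_Diff_subset[of "?Q \<times> ?Q" "P \<times> P"]
    by (metis Sigma_mono card_cartesian_product finite_cartesian_product finite_Diff Diff_subset)
  also have "\<dots> = 2 * card P - 1"
  proof -
    obtain m where "card P = Suc m" using delete(4) fin by (metis card_gt_0_iff empty_iff gr0_implies_Suc)
    then show ?thesis using delete(4) fin by simp
  qed
  finally have "card {ab. T ab \<noteq> (T |` (?Q \<times> ?Q)) ab} \<le> 2 * card P - 1" .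
  moreover have "dom (T |` (?Q \<times> ?Q)) = ?Q \<times> ?Q" using fin(2) by auto
  ultimately show ?thesis using delete(1-3) fin unfolding is_table_def by simp
qed

lemma finite_table_difference:
  assumes "is_table S" "is_table S'"
  shows "finite {ab. snd S ab \<noteq> snd S' ab}"
proof (rule finite_subset)
  show "{ab. snd S ab \<noteq> snd S' ab} \<subseteq> dom (snd S) \<union> dom (snd S')" by (auto simp: domIff)
  show "finite (dom (snd S) \<union> dom (snd S'))" using assms unfolding is_table_def by simp
qed

lemma edit_path_is_table_and_cost:
  assumes "edit_path S c S'" "is_table S"
  shows "is_table S' \<and> card {ab. snd S ab \<noteq> snd S' ab} \<le> c"
  using assms
proof (induction rule: edit_path.induct)
  case (refl S)
  then show ?case by simp
next
  case (step S c S' d S'')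
  note IH = step.IH[OF step.prems]
  note st = edit_step_is_table_and_cost[OF step.hyps(2) conjunct1[OF IH]]
  have "{ab. snd S ab \<noteq> snd S'' ab} \<subseteq> {ab. snd S ab \<noteq> snd S' ab} \<union> {ab. snd S' ab \<noteq> snd S'' ab}" by auto
  then have "card {ab. snd S ab \<noteq> snd S'' ab} \<le> card ({ab. snd S ab \<noteq> snd S' ab} \<union> {ab. snd S' ab \<noteq> snd S'' ab})"
    using step.prems IH st by (intro card_mono finite_UnI finite_table_difference) auto
  also have "\<dots> \<le> c + d" using IH st by (intro order.trans[OF card_Un_le] add_mono) auto
  finally show ?case using st by simp
qed

lemma edit_path_trans:
  assumes "edit_path S' d S''" "edit_path S c S'"
  shows "\<exists>c. edit_path S c S''"
  using assms by (induction rule: edit_path.induct) (blast intro: edit_path.step)+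

text \<open>\<open>table_edit\<close> is a \<open>LEAST\<close> over paths and is informative only
  once some path exists. Emptying the first table and then building up the second provides
  one.\<close>

lemma edit_path_to_empty:
  assumes "finite P" "dom T = P \<times> P"
  shows "\<exists>c. edit_path (P, T) c ({}, Map.empty)"
  using assms
proof (induction P arbitrary: T rule: finite_induct)
  case empty
  then show ?case by (auto intro: edit_path.refl)
next
  case (insert a P)
  have "edit_step (insert a P, T) (2 * card (insert a P) - 1) (insert a P - {a}, T |` ((insert a P - {a}) \<times> (insert a P - {a})))"
    by (rule edit_step.delete) simp
  moreover have "insert a P - {a} = P" using insert by auto
  ultimately have "edit_step (insert a P, T) (2 * card (insert a P) - 1) (P, T |` (P \<times> P))" by simp
  from edit_path.step[OF edit_path.refl this]
  have "edit_path (insert a P, T) (0 + (2 * card (insert a P) - 1)) (P, T |` (P \<times> P))" .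
  moreover have "\<exists>c. edit_path (P, T |` (P \<times> P)) c ({}, Map.empty)"
    using insert by (intro insert.IH) auto
  ultimately show ?case using edit_path_trans by blast
qed

lemma edit_path_from_empty:
  assumes "finite P" "dom T = P \<times> P"
  shows "\<exists>c. edit_path ({}, Map.empty) c (P, T)"
  using assms
proof (induction P arbitrary: T rule: finite_induct)
  case empty
  then show ?case by (auto intro: edit_path.refl)
next
  case (insert a P)
  have "\<exists>c. edit_path ({}, Map.empty) c (P, T |` (P \<times> P))"
    using insert by (intro insert.IH) auto
  moreover have "edit_step (P, T |` (P \<times> P)) (2 * card P + 1) (insert a P, T)"
    using insert by (intro edit_step.insert) auto
  ultimately show ?case by (blast intro: edit_path.step)
qed

lemma table_edit_ge_difference:
  assumes "is_table S" "is_table S'"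
  shows "card {ab. snd S ab \<noteq> snd S' ab} \<le> table_edit S S'"
proof -
  obtain P T P' T' where S: "S = (P, T)" "S' = (P', T')" by (metis surj_pair)
  have "\<exists>c. edit_path S c S'"
    using edit_path_to_empty[of P T] edit_path_from_empty[of P' T'] assms edit_path_trans
    unfolding S is_table_def by (metis fst_conv snd_conv)
  then have "edit_path S (table_edit S S') S'" unfolding table_edit_def by (rule LeastI_ex)
  with edit_path_is_table_and_cost assms(1) show ?thesis by blast
qed

text \<open>Serves the \<open>LEAST\<close> in \<open>edit\<close> in the same way; the elements are
  their own labels.\<close>

lemma multiplication_table_exists:
  fixes \<Gamma> :: "nat set"
  assumes "finite \<Gamma>" "\<And>x y. x \<in> \<Gamma> \<Longrightarrow> y \<in> \<Gamma> \<Longrightarrow> f x y \<in> \<Gamma>"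
  shows "\<exists>S. multiplication_table \<Gamma> f S"
proof -
  define S :: table where "S = (\<Gamma>, \<lambda>(a, b). if a \<in> \<Gamma> \<and> b \<in> \<Gamma> then Some (f a b) else None)"
  have "is_table S" unfolding is_table_def S_def using assms(1) by (auto split: if_splits)
  moreover have "inv_into \<Gamma> id x = x" if "x \<in> \<Gamma>" for x
    using inv_into_f_f[of id \<Gamma> x] that by simp
  ultimately have "multiplication_table \<Gamma> f S"
    unfolding multiplication_table_def using assms(2)
    by (intro conjI exI[of _ id]) (auto simp: S_def)
  then show ?thesis by blast
qed

section \<open>Small distance yields an embedding\<close>

lemma hamming_embedding:
  assumes G: "group \<lparr>carrier = \<Gamma>, monoid.mult = f, one = e\<rparr>"
    and H: "group \<lparr>carrier = \<Gamma>, monoid.mult = g, one = e'\<rparr>"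
    and fin: "finite \<Gamma>" and close: "23 * Ham \<Gamma> f g < (card \<Gamma>)\<^sup>2"
  shows "\<exists>\<psi>\<in>hom \<lparr>carrier = \<Gamma>, monoid.mult = f, one = e\<rparr> \<lparr>carrier = \<Gamma>, monoid.mult = g, one = e'\<rparr>. inj_on \<psi> \<Gamma>"
proof (rule approximate_embedding_correction[OF G H, of id \<Gamma> "{(x, y) \<in> \<Gamma> \<times> \<Gamma>. f x y \<noteq> g x y}", simplified])
  show "finite {(x, y). x \<in> \<Gamma> \<and> y \<in> \<Gamma> \<and> f x y \<noteq> g x y}"
    by (rule finite_subset[of _ "\<Gamma> \<times> \<Gamma>"]) (use fin in auto)
  show "23 * card {(x, y). x \<in> \<Gamma> \<and> y \<in> \<Gamma> \<and> f x y \<noteq> g x y} < (card \<Gamma>)\<^sup>2"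
    using close unfolding Ham_def by simp
qed (use fin in auto)

lemma edit_embedding:
  fixes \<Gamma> \<Gamma>' :: "nat set"
  assumes G: "group \<lparr>carrier = \<Gamma>, monoid.mult = f, one = e\<rparr>"
    and H: "group \<lparr>carrier = \<Gamma>', monoid.mult = g, one = e'\<rparr>"
    and fin: "finite \<Gamma>" "finite \<Gamma>'" and close: "23 * edit \<Gamma> f \<Gamma>' g < (card \<Gamma>)\<^sup>2"
  shows "\<exists>\<psi>\<in>hom \<lparr>carrier = \<Gamma>, monoid.mult = f, one = e\<rparr> \<lparr>carrier = \<Gamma>', monoid.mult = g, one = e'\<rparr>. inj_on \<psi> \<Gamma>"
proof -
  have fc: "f x y \<in> \<Gamma>" if "x \<in> \<Gamma>" "y \<in> \<Gamma>" for x y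
    using group.subgroup_self[OF G] subgroup.m_closed that by fastforce
  have gc: "g x y \<in> \<Gamma>'" if "x \<in> \<Gamma>'" "y \<in> \<Gamma>'" for x y
    using group.subgroup_self[OF H] subgroup.m_closed that by fastforce
  have e': "e' \<in> \<Gamma>'" using group.is_monoid[OF H] monoid.one_closed by fastforce
  have "\<exists>d S S'. multiplication_table \<Gamma> f S \<and> multiplication_table \<Gamma>' g S' \<and> d = table_edit S S'"
    using multiplication_table_exists[of \<Gamma> f] multiplication_table_exists[of \<Gamma>' g] fc gc fin by blast
  then have "\<exists>S S'. multiplication_table \<Gamma> f S \<and> multiplication_table \<Gamma>' g S' \<and> edit \<Gamma> f \<Gamma>' g = table_edit S S'"
    unfolding edit_def by (rule LeastI_ex)
  then obtain P T P' T' where S: "multiplication_table \<Gamma> f (P, T)" "multiplication_table \<Gamma>' g (P', T')"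
    "edit \<Gamma> f \<Gamma>' g = table_edit (P, T) (P', T')" by (metis surj_pair)
  obtain \<sigma> where \<sigma>: "bij_betw \<sigma> P \<Gamma>" "dom T = P \<times> P" "is_table (P, T)"
    "\<And>a b. a \<in> P \<Longrightarrow> b \<in> P \<Longrightarrow> T (a, b) = Some (inv_into P \<sigma> (f (\<sigma> a) (\<sigma> b)))"
    using S(1) unfolding multiplication_table_def is_table_def by auto
  obtain \<sigma>' where \<sigma>': "bij_betw \<sigma>' P' \<Gamma>'" "dom T' = P' \<times> P'" "is_table (P', T')"
    "\<And>a b. a \<in> P' \<Longrightarrow> b \<in> P' \<Longrightarrow> T' (a, b) = Some (inv_into P' \<sigma>' (g (\<sigma>' a) (\<sigma>' b)))"
    using S(2) unfolding multiplication_table_def is_table_def by auto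
  define D where "D = {ab. T ab \<noteq> T' ab}"
  have finD: "finite D" using finite_table_difference[OF \<sigma>(3) \<sigma>'(3)] unfolding D_def by simp
  have "card D \<le> edit \<Gamma> f \<Gamma>' g"
    using table_edit_ge_difference[OF \<sigma>(3) \<sigma>'(3)] S(3) unfolding D_def by simp
  then have cD: "23 * card D < (card \<Gamma>)\<^sup>2" using close by linarith
  define \<tau> where "\<tau> = inv_into P \<sigma>"
  have \<tau>: "\<tau> x \<in> P" "\<sigma> (\<tau> x) = x" if "x \<in> \<Gamma>" for x
    unfolding \<tau>_def using that \<sigma>(1) by (auto simp: bij_betw_def inv_into_into f_inv_into_f)
  \<comment> \<open>An element of the first group goes to the element of the second with the same
    label. The default \<open>e'\<close> is used only outside \<open>K\<close>.\<close>
  define \<phi> where "\<phi> = (\<lambda>x. if \<tau> x \<in> P' then \<sigma>' (\<tau> x) else e')"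
  define K where "K = {x \<in> \<Gamma>. \<tau> x \<in> P'}"
  define B where "B = map_prod \<sigma> \<sigma> ` D"
  show ?thesis
  proof (rule approximate_embedding_correction[OF G H, of \<phi> K B, simplified])
    show "finite \<Gamma>" by fact
    show "\<phi> \<in> \<Gamma> \<rightarrow> \<Gamma>'" unfolding \<phi>_def using e' bij_betwE[OF \<sigma>'(1)] by auto
    show "K \<subseteq> \<Gamma>" unfolding K_def by auto
    show "inj_on \<phi> K"
    proof (rule inj_onI)
      fix x y assume xy: "x \<in> K" "y \<in> K" "\<phi> x = \<phi> y"
      then have "\<tau> x = \<tau> y" using bij_betw_imp_inj_on[OF \<sigma>'(1)] unfolding K_def \<phi>_def inj_on_def by auto
      then show "x = y" using xy \<tau> unfolding K_def by (metis (lifting) mem_Collect_eq)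
    qed
    show "finite B" unfolding B_def using finD by simp
    have "card B \<le> card D" unfolding B_def by (rule card_image_le[OF finD])
    then show "23 * card B < (card \<Gamma>)\<^sup>2" using cD by linarith
    fix x y assume xy: "x \<in> \<Gamma>" "y \<in> \<Gamma>" "(x, y) \<notin> B"
    have "(\<tau> x, \<tau> y) \<notin> D"
    proof
      assume "(\<tau> x, \<tau> y) \<in> D"
      then have "map_prod \<sigma> \<sigma> (\<tau> x, \<tau> y) \<in> B" unfolding B_def by (rule imageI)
      then show False using xy \<tau> by simp
    qed
    then have eq: "T (\<tau> x, \<tau> y) = T' (\<tau> x, \<tau> y)" unfolding D_def by simp
    have T: "T (\<tau> x, \<tau> y) = Some (\<tau> (f x y))" using \<sigma>(4)[of "\<tau> x" "\<tau> y"] \<tau> xy unfolding \<tau>_def by simp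
    \<comment> \<open>Agreement of the tables at an entry includes agreement on being defined, so
      both labels occur in the second table too.\<close>
    then have "(\<tau> x, \<tau> y) \<in> dom T'" using eq by auto
    then have P': "\<tau> x \<in> P'" "\<tau> y \<in> P'" using \<sigma>'(2) by auto
    then have t: "\<tau> (f x y) = inv_into P' \<sigma>' (g (\<sigma>' (\<tau> x)) (\<sigma>' (\<tau> y)))" using \<sigma>'(4) T eq by simp
    have "g (\<sigma>' (\<tau> x)) (\<sigma>' (\<tau> y)) \<in> \<Gamma>'" using P' bij_betwE[OF \<sigma>'(1)] gc by blast
    then have "\<tau> (f x y) \<in> P'" "\<sigma>' (\<tau> (f x y)) = g (\<sigma>' (\<tau> x)) (\<sigma>' (\<tau> y))"
      unfolding t using \<sigma>'(1) by (auto simp: bij_betw_def inv_into_into f_inv_into_f)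
    then show "x \<in> K \<and> \<phi> (f x y) = g (\<phi> x) (\<phi> y)" unfolding K_def \<phi>_def using xy P' by simp
  qed
qed

lemma far_if_no_embedding:
  fixes \<Gamma> :: "nat set"
  assumes G: "group \<lparr>carrier = \<Gamma>, monoid.mult = f, one = e\<rparr>" and fin: "finite \<Gamma>" and \<epsilon>: "\<epsilon> \<le> 1/23"
    and C: "\<And>\<Gamma>' g. C \<Gamma>' g \<Longrightarrow> finite \<Gamma>' \<and> (\<exists>e'. group \<lparr>carrier = \<Gamma>', monoid.mult = g, one = e'\<rparr> \<and>
      \<not> (\<exists>\<psi>\<in>hom \<lparr>carrier = \<Gamma>, monoid.mult = f, one = e\<rparr> \<lparr>carrier = \<Gamma>', monoid.mult = g, one = e'\<rparr>. inj_on \<psi> \<Gamma>))"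
    and far: "far \<in> {hamming_far, edit_far}"
  shows "far C \<epsilon> \<Gamma> f"
proof -
  have bound: "\<epsilon> * (real (card \<Gamma>))\<^sup>2 \<le> real d" if "\<not> 23 * d < (card \<Gamma>)\<^sup>2" for d
  proof -
    have "real ((card \<Gamma>)\<^sup>2) \<le> real (23 * d)" using that by (intro of_nat_mono) simp
    then have "(real (card \<Gamma>))\<^sup>2 \<le> 23 * real d" by simp
    moreover have "\<epsilon> * (real (card \<Gamma>))\<^sup>2 \<le> 1/23 * (real (card \<Gamma>))\<^sup>2" using \<epsilon> by (intro mult_right_mono) auto
    ultimately show ?thesis by linarith
  qed
  have "hamming_far C \<epsilon> \<Gamma> f"
    unfolding hamming_far_def using C hamming_embedding[OF G _ fin] by (blast intro: bound)
  moreover have "edit_far C \<epsilon> \<Gamma> f"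
    unfolding edit_far_def using C edit_embedding[OF G _ fin] by (blast intro: bound)
  ultimately show ?thesis using far by auto
qed

section \<open>Torsion in products of cyclic groups\<close>

abbreviation cyclic_product :: "nat \<Rightarrow> (nat \<Rightarrow> nat) \<Rightarrow> (nat \<Rightarrow> int) monoid" where
  "cyclic_product r m \<equiv> product_group {..<r} (\<lambda>i. integer_mod_group (m i))"

lemma nat_pow_product_group:
  assumes "\<And>i. i \<in> I \<Longrightarrow> group (G i)" "x \<in> carrier (product_group I G)"
  shows "x [^]\<^bsub>product_group I G\<^esub> (j::nat) = (\<lambda>i\<in>I. x i [^]\<^bsub>G i\<^esub> j)"
proof (induction j)
  case 0
  then show ?case by simp
next
  case (Suc j)
  then show ?case using assms by (simp add: fun_eq_iff)
qed

lemma carrier_cyclic_product: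
  assumes "\<forall>i<r. 0 < m i"
  shows "carrier (cyclic_product r m) = PiE {..<r} (\<lambda>i. {0..<int (m i)})"
  unfolding carrier_product_group
  by (rule PiE_cong) (use assms in \<open>auto simp: carrier_integer_mod_group split: if_splits\<close>)

lemma finite_cyclic_product:
  assumes "\<forall>i<r. 0 < m i"
  shows "finite (carrier (cyclic_product r m))"
  unfolding carrier_cyclic_product[OF assms] by (intro finite_PiE) auto

lemma torsion_cyclic_product:
  assumes "\<forall>i<r. 0 < m i"
  shows "{x \<in> carrier (cyclic_product r m). x [^]\<^bsub>cyclic_product r m\<^esub> p = \<one>\<^bsub>cyclic_product r m\<^esub>}
    = PiE {..<r} (\<lambda>i. {y \<in> {0..<int (m i)}. (int p * y) mod int (m i) = 0})"
proof -
  have *: "x [^]\<^bsub>cyclic_product r m\<^esub> p = (\<lambda>i\<in>{..<r}. (int p * x i) mod int (m i))"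
    if "x \<in> carrier (cyclic_product r m)" for x
    by (subst nat_pow_product_group[OF _ that]) (auto simp: fun_eq_iff)
  show ?thesis
  proof (intro equalityI subsetI)
    fix x assume "x \<in> {x \<in> carrier (cyclic_product r m). x [^]\<^bsub>cyclic_product r m\<^esub> p = \<one>\<^bsub>cyclic_product r m\<^esub>}"
    then have x: "x \<in> carrier (cyclic_product r m)" "(\<lambda>i\<in>{..<r}. (int p * x i) mod int (m i)) = (\<lambda>i\<in>{..<r}. 0)"
      using * by auto
    then have "(int p * x i) mod int (m i) = 0" if "i < r" for i
      using that by (metis (no_types, lifting) restrict_apply' lessThan_iff x(2))
    then show "x \<in> PiE {..<r} (\<lambda>i. {y \<in> {0..<int (m i)}. (int p * y) mod int (m i) = 0})"
      using x(1) unfolding carrier_cyclic_product[OF assms] by (auto simp: PiE_iff)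
  next
    fix x assume x: "x \<in> PiE {..<r} (\<lambda>i. {y \<in> {0..<int (m i)}. (int p * y) mod int (m i) = 0})"
    then have "x \<in> carrier (cyclic_product r m)"
      unfolding carrier_cyclic_product[OF assms] by (auto simp: PiE_iff)
    moreover from this x have "x [^]\<^bsub>cyclic_product r m\<^esub> p = \<one>\<^bsub>cyclic_product r m\<^esub>"
      by (subst *) (auto simp: fun_eq_iff PiE_iff)
    ultimately show "x \<in> {x \<in> carrier (cyclic_product r m). x [^]\<^bsub>cyclic_product r m\<^esub> p = \<one>\<^bsub>cyclic_product r m\<^esub>}"
      by simp
  qed
qed

text \<open>If m divides p y and 0 <= y < m, then the quotient p y / m lies in [0, p) and determines
  y.\<close>

lemma card_cyclic_torsion_le:
  assumes "0 < m" "0 < p"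
  shows "card {y \<in> {0..<int m}. (int p * y) mod int m = 0} \<le> p"
proof -
  let ?S = "{y \<in> {0..<int m}. (int p * y) mod int m = 0}"
  have t: "(int p * y) div int m * int m = int p * y" if "y \<in> ?S" for y
    using that by (auto simp: mod_0_imp_dvd)
  have "inj_on (\<lambda>y. (int p * y) div int m) ?S"
  proof (rule inj_onI)
    fix y y' assume "y \<in> ?S" "y' \<in> ?S" "(int p * y) div int m = (int p * y') div int m"
    then have "int p * y = int p * y'" using t by metis
    then show "y = y'" using assms by simp
  qed
  moreover have "(int p * y) div int m \<in> {0..<int p}" if y: "y \<in> ?S" for y
  proof -
    have "0 \<le> int p * y" "int p * y < int p * int m" using y assms by auto
    then have "0 \<le> (int p * y) div int m" "(int p * y) div int m * int m < int p * int m"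
      using t[OF y] by (auto simp: div_int_pos_iff)
    then show ?thesis using assms by simp
  qed
  ultimately have "card ?S \<le> card {0..<int p}" by (intro card_inj_on_le) auto
  then show ?thesis by simp
qed

lemma card_cyclic_torsion_ge:
  assumes "0 < m" "p dvd m"
  shows "p \<le> card {y \<in> {0..<int m}. (int p * y) mod int m = 0}"
proof -
  obtain c where c: "m = p * c" using assms(2) by blast
  have "(\<lambda>t. int c * t) ` {0..<int p} \<subseteq> {y \<in> {0..<int m}. (int p * y) mod int m = 0}"
    using assms(1) unfolding c by (auto simp: mult.commute mult.left_commute)
  moreover have "inj_on (\<lambda>t. int c * t) {0..<int p}" using assms(1) unfolding c by (auto simp: inj_on_def)
  moreover have "finite {y \<in> {0..<int m}. (int p * y) mod int m = 0}"
    by (rule finite_subset[of _ "{0..<int m}"]) auto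
  ultimately have "card {0..<int p} \<le> card {y \<in> {0..<int m}. (int p * y) mod int m = 0}"
    by (metis card_image card_mono)
  then show ?thesis by simp
qed

text \<open>An embedding carries elements killed by p injectively to elements killed by p. Each
  source factor contributes at least p of them and each target factor at most p, so p^s <=
  p^r.\<close>

lemma no_embedding_fewer_factors:
  assumes m: "\<And>i. i < s \<Longrightarrow> 0 < m i \<and> p dvd m i" and m': "\<And>i. i < r \<Longrightarrow> 0 < m' i"
    and p: "2 \<le> p" and h: "h \<in> hom (cyclic_product s m) (cyclic_product r m')"
    "inj_on h (carrier (cyclic_product s m))"
  shows "s \<le> r"
proof -
  let ?tors = "\<lambda>r m. {x \<in> carrier (cyclic_product r m). x [^]\<^bsub>cyclic_product r m\<^esub> p = \<one>\<^bsub>cyclic_product r m\<^esub>}"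
  interpret group_hom "cyclic_product s m" "cyclic_product r m'" h
    using h(1) by (auto simp: group_hom_def group_hom_axioms_def)
  have "h ` ?tors s m \<subseteq> ?tors r m'"
    using hom_closed hom_nat_pow hom_one by (smt (verit) image_subsetI mem_Collect_eq)
  moreover have fin: "finite (?tors r m')"
    using finite_cyclic_product[of r m'] m' by (auto intro: finite_subset[rotated])
  moreover have "inj_on h (?tors s m)" using h(2) by (rule inj_on_subset) auto
  ultimately have "card (?tors s m) \<le> card (?tors r m')" by (intro card_inj_on_le)
  moreover have "p ^ s \<le> card (?tors s m)"
  proof -
    have "(\<Prod>i<s. p) \<le> (\<Prod>i<s. card {y \<in> {0..<int (m i)}. (int p * y) mod int (m i) = 0})"
      using m by (intro prod_mono conjI card_cyclic_torsion_ge) auto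
    then show ?thesis using m by (subst torsion_cyclic_product) (auto simp: card_PiE)
  qed
  moreover have "card (?tors r m') \<le> p ^ r"
  proof -
    have "(\<Prod>i<r. card {y \<in> {0..<int (m' i)}. (int p * y) mod int (m' i) = 0}) \<le> (\<Prod>i<r. p)"
      using m' p by (intro prod_mono conjI card_cyclic_torsion_le) auto
    then show ?thesis using m' by (subst torsion_cyclic_product) (auto simp: card_PiE)
  qed
  ultimately have "p ^ s \<le> p ^ r" by linarith
  then show ?thesis using p by (simp add: power_increasing_iff)
qed

lemma cyclic_product_far:
  fixes \<Gamma> :: "nat set"
  assumes G: "group \<lparr>carrier = \<Gamma>, monoid.mult = f, one = e\<rparr>" and fin: "finite \<Gamma>"
    and iso: "\<lparr>carrier = \<Gamma>, monoid.mult = f, one = e\<rparr> \<cong> cyclic_product s m"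
    and m: "\<And>i. i < s \<Longrightarrow> 0 < m i \<and> p dvd m i" and p: "2 \<le> p" and k: "k < s"
    and \<epsilon>: "\<epsilon> \<le> 1/23" and far: "far \<in> {hamming_far, edit_far}"
  shows "far (abelian_generated_by k) \<epsilon> \<Gamma> f"
proof (rule far_if_no_embedding[OF G fin \<epsilon> _ far])
  fix \<Gamma>' :: "nat set" and g
  let ?G = "\<lparr>carrier = \<Gamma>, monoid.mult = f, one = e\<rparr>"
  assume "abelian_generated_by k \<Gamma>' g"
  then obtain e' r m' where *: "comm_group \<lparr>carrier = \<Gamma>', monoid.mult = g, one = e'\<rparr>" "r \<le> k" "\<And>i. i < r \<Longrightarrow> 0 < m' i"
    "\<lparr>carrier = \<Gamma>', monoid.mult = g, one = e'\<rparr> \<cong> cyclic_product r m'"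
    unfolding abelian_generated_by_def by blast
  let ?H = "\<lparr>carrier = \<Gamma>', monoid.mult = g, one = e'\<rparr>"
  have H: "group ?H" using *(1) by (simp add: comm_group_def)
  obtain h' where h': "h' \<in> iso ?H (cyclic_product r m')" using *(4) unfolding is_iso_def by blast
  then have "bij_betw h' \<Gamma>' (carrier (cyclic_product r m'))" by (simp add: iso_def)
  moreover have "finite (carrier (cyclic_product r m'))"
    by (rule finite_cyclic_product) (use *(3) in auto)
  ultimately have "finite \<Gamma>'" using bij_betw_finite by blast
  moreover have "\<not> (\<exists>\<psi>\<in>hom ?G ?H. inj_on \<psi> \<Gamma>)"
  proof
    assume "\<exists>\<psi>\<in>hom ?G ?H. inj_on \<psi> \<Gamma>"
    then obtain \<psi> where \<psi>: "\<psi> \<in> hom ?G ?H" "inj_on \<psi> \<Gamma>" by blast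
    obtain h where h: "h \<in> iso (cyclic_product s m) ?G"
      using group.iso_sym[OF G iso] unfolding is_iso_def by blast
    have hb: "h \<in> hom (cyclic_product s m) ?G" "bij_betw h (carrier (cyclic_product s m)) \<Gamma>" using h by (auto simp: iso_def)
    have h'b: "h' \<in> hom ?H (cyclic_product r m')" "bij_betw h' \<Gamma>' (carrier (cyclic_product r m'))" using h' by (auto simp: iso_def)
    have "h' \<circ> (\<psi> \<circ> h) \<in> hom (cyclic_product s m) (cyclic_product r m')"
      using hom_compose[OF hom_compose[OF hb(1) \<psi>(1)] h'b(1)] .
    moreover have "\<psi> ` \<Gamma> \<subseteq> \<Gamma>'" using \<psi>(1) by (auto simp: hom_def)
    then have sub: "(\<psi> \<circ> h) ` carrier (cyclic_product s m) \<subseteq> \<Gamma>'"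
      using hb(2) unfolding bij_betw_def image_comp[symmetric] by simp
    have "inj_on (\<psi> \<circ> h) (carrier (cyclic_product s m))"
      by (rule comp_inj_on) (use hb(2) \<psi>(2) in \<open>simp_all add: bij_betw_def del: carrier_product_group\<close>)
    then have "inj_on (h' \<circ> (\<psi> \<circ> h)) (carrier (cyclic_product s m))"
      using inj_on_subset[OF bij_betw_imp_inj_on[OF h'b(2)] sub] by (rule comp_inj_on)
    ultimately have "s \<le> r" using no_embedding_fewer_factors[of s m p r m'] m *(3) p by blast
    with *(2) k show False by simp
  qed
  ultimately show "finite \<Gamma>' \<and> (\<exists>e'. group \<lparr>carrier = \<Gamma>', monoid.mult = g, one = e'\<rparr> \<and>
      \<not> (\<exists>\<psi>\<in>hom ?G \<lparr>carrier = \<Gamma>', monoid.mult = g, one = e'\<rparr>. inj_on \<psi> \<Gamma>))"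
    using H by blast
qed

section \<open>Generic algorithms on randomly labelled groups\<close>

text \<open>Fix one permutation \<open>s\<close> that extends \<open>g\<close>. Composing it with
  the permutations of \<open>Z - D\<close> gives (card Z - card D)! distinct extensions.\<close>

lemma card_permutes_extending_ge:
  fixes Z :: "'z set"
  assumes Z: "finite Z" and D: "D \<subseteq> Z" and g: "inj_on g D" "g ` D \<subseteq> Z"
  shows "fact (card Z - card D) \<le> card {\<sigma>. \<sigma> permutes Z \<and> (\<forall>z\<in>D. \<sigma> z = g z)}"
proof -
  have fin: "finite D" using D Z finite_subset by blast
  have "card (Z - D) = card (Z - g ` D)"
    using D g Z fin by (simp add: card_Diff_subset card_image)
  then obtain t where t: "bij_betw t (Z - D) (Z - g ` D)"
    using finite_same_card_bij[of "Z - D" "Z - g ` D"] Z by auto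
  define s where "s = (\<lambda>z. if z \<in> D then g z else if z \<in> Z then t z else z)"
  have "bij_betw s (D \<union> (Z - D)) (g ` D \<union> (Z - g ` D))"
  proof (rule bij_betw_combine)
    show "bij_betw s D (g ` D)" using g(1) unfolding s_def bij_betw_def by (auto simp: inj_on_def)
    show "bij_betw s (Z - D) (Z - g ` D)" using t by (subst bij_betw_cong[of _ _ t]) (auto simp: s_def)
  qed auto
  moreover have "D \<union> (Z - D) = Z" "g ` D \<union> (Z - g ` D) = Z" using D g by auto
  ultimately have s: "s permutes Z" using D by (auto intro!: bij_imp_permutes simp: s_def)
  have "(\<lambda>\<kappa>. s \<circ> \<kappa>) ` {\<kappa>. \<kappa> permutes (Z - D)} \<subseteq> {\<sigma>. \<sigma> permutes Z \<and> (\<forall>z\<in>D. \<sigma> z = g z)}"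
  proof safe
    fix \<kappa> assume \<kappa>: "\<kappa> permutes (Z - D)"
    then show "(s \<circ> \<kappa>) permutes Z"
      using s by (intro permutes_compose) (auto intro: permutes_subset)
    fix z assume "z \<in> D"
    then have "\<kappa> z = z" using \<kappa> by (intro permutes_not_in) auto
    then show "(s \<circ> \<kappa>) z = g z" using \<open>z \<in> D\<close> by (simp add: s_def)
  qed
  moreover have "finite {\<sigma>. \<sigma> permutes Z \<and> (\<forall>z\<in>D. \<sigma> z = g z)}"
    using finite_permutations[OF Z] by (rule finite_subset[rotated]) auto
  ultimately have "card ((\<lambda>\<kappa>. s \<circ> \<kappa>) ` {\<kappa>. \<kappa> permutes (Z - D)}) \<le> card {\<sigma>. \<sigma> permutes Z \<and> (\<forall>z\<in>D. \<sigma> z = g z)}"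
    by (intro card_mono)
  moreover have "inj_on (\<lambda>\<kappa>. s \<circ> \<kappa>) {\<kappa>. \<kappa> permutes (Z - D)}"
    using permutes_inj[OF s] by (auto intro!: inj_onI ext simp: fun_eq_iff inj_eq)
  moreover have "card {\<kappa>. \<kappa> permutes (Z - D)} = fact (card Z - card D)"
    using D Z fin by (intro card_permutations) (auto simp: card_Diff_subset)
  ultimately show ?thesis by (simp add: card_image)
qed

text \<open>Runs with more than \<open>T\<close> queries count as successful for both answers. This makes a recursion
  on the budget \<open>T\<close> possible, and changes nothing for algorithms that make at most \<open>T\<close> queries.\<close>

definition accept_prob :: "sample_oracle \<Rightarrow> mult_oracle \<Rightarrow> algorithm \<Rightarrow> bool \<Rightarrow> nat \<Rightarrow> real" where
  "accept_prob O1 O2 A b T = pmf (map_pmf (\<lambda>(b', c). b' = b \<or> T < c) (run O1 O2 A)) True"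

lemma accept_prob_bounds: "0 \<le> accept_prob O1 O2 A b T" "accept_prob O1 O2 A b T \<le> 1"
  unfolding accept_prob_def by (auto simp: pmf_le_1)

lemma accept_prob_Answer [simp]: "accept_prob O1 O2 (Answer b') b T = (if b' = b then 1 else 0)"
  unfolding accept_prob_def by simp

lemma accept_prob_Random [simp]:
  "accept_prob O1 O2 (Random p A) b T = measure_pmf.expectation p (\<lambda>i. accept_prob O1 O2 (A i) b T)"
  unfolding accept_prob_def by (simp add: map_bind_pmf pmf_bind)

lemma accept_prob_query_0 [simp]:
  "accept_prob O1 O2 (Sample A') b 0 = 1" "accept_prob O1 O2 (Multiply z1 z2 A') b 0 = 1"
  unfolding accept_prob_def
  by (simp_all add: map_pmf_comp case_prod_unfold)

lemma accept_prob_Sample [simp]: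
  "accept_prob O1 O2 (Sample A) b (Suc T) = measure_pmf.expectation O1 (\<lambda>z. accept_prob O1 O2 (A z) b T)"
  unfolding accept_prob_def
  by (simp add: map_pmf_comp case_prod_unfold map_bind_pmf pmf_bind)

lemma accept_prob_Multiply [simp]:
  "accept_prob O1 O2 (Multiply z1 z2 A) b (Suc T) = accept_prob O1 O2 (A (O2 z1 z2)) b T"
  unfolding accept_prob_def
  by (simp add: map_pmf_comp case_prod_unfold)

lemma integrable_measure_pmf_unit_interval:
  fixes f :: "'a \<Rightarrow> real"
  assumes "\<And>i. 0 \<le> f i" "\<And>i. f i \<le> 1"
  shows "integrable (measure_pmf p) f"
  by (rule measure_pmf.integrable_const_bound[of _ 1]) (use assms in \<open>auto simp: abs_le_iff\<close>)

text \<open>Carries a bound that is summed over labellings through one random draw. It fits internal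
  randomness and sampling alike, because neither distribution depends on the labelling.\<close>

lemma sum_expectation_ge:
  fixes f :: "'s \<Rightarrow> 'i \<Rightarrow> real"
  assumes "finite S" "\<And>i. c * h i \<le> (\<Sum>\<sigma>\<in>S. f \<sigma> i)"
    and "\<And>\<sigma> i. 0 \<le> f \<sigma> i" "\<And>\<sigma> i. f \<sigma> i \<le> 1" "\<And>i. 0 \<le> h i" "\<And>i. h i \<le> 1"
  shows "c * measure_pmf.expectation p h \<le> (\<Sum>\<sigma>\<in>S. measure_pmf.expectation p (f \<sigma>))"
proof -
  have f: "integrable (measure_pmf p) (f \<sigma>)" for \<sigma> using assms by (intro integrable_measure_pmf_unit_interval)
  have h: "integrable (measure_pmf p) h" using assms by (intro integrable_measure_pmf_unit_interval)
  have "c * measure_pmf.expectation p h = measure_pmf.expectation p (\<lambda>i. c * h i)" using h by simp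
  also have "\<dots> \<le> measure_pmf.expectation p (\<lambda>i. \<Sum>\<sigma>\<in>S. f \<sigma> i)"
    using f h assms(2) by (intro integral_mono) auto
  also have "\<dots> = (\<Sum>\<sigma>\<in>S. measure_pmf.expectation p (f \<sigma>))"
    using f by (intro Bochner_Integration.integral_sum) auto
  finally show ?thesis .
qed

section \<open>Words, knowledge and the simulated run\<close>

definition unit_word :: "nat \<Rightarrow> nat \<Rightarrow> int" where
  "unit_word v = (\<lambda>i. if i = v then 1 else 0)"

definition add_word :: "int \<Rightarrow> (nat \<Rightarrow> int) \<Rightarrow> (nat \<Rightarrow> int) \<Rightarrow> nat \<Rightarrow> int" where
  "add_word M w w' = (\<lambda>i. (w i + w' i) mod M)"

text \<open>Canonical representatives of the free module on v variables as total functions, so that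
  equality in the module is equality of functions.\<close>

definition reduced_word :: "int \<Rightarrow> nat \<Rightarrow> (nat \<Rightarrow> int) \<Rightarrow> bool" where
  "reduced_word M v w \<longleftrightarrow> (\<forall>i. 0 \<le> w i \<and> w i < M) \<and> (\<forall>i\<ge>v. w i = 0)"

text \<open>What a generic algorithm knows: the labels it has seen, each with a word expressing the
  element as a combination of free variables, and the number of variables introduced so far.\<close>

type_synonym knowledge = "(bool list \<rightharpoonup> (nat \<Rightarrow> int)) \<times> nat"

definition register :: "bool list \<Rightarrow> knowledge \<Rightarrow> knowledge" where
  "register z K = (if fst K z = None then ((fst K)(z \<mapsto> unit_word (snd K)), Suc (snd K)) else K)"

text \<open>The algorithm run against the free \<open>\<int>/M\<close>-module on the variables, with answers given by fresh
  random labels unless the word is already known. No group enters the definition. When the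
  query budget \<open>T\<close> is exhausted the answer is arbitrary.\<close>

primrec ideal :: "int \<Rightarrow> bool list set \<Rightarrow> algorithm \<Rightarrow> nat \<Rightarrow> knowledge \<Rightarrow> bool pmf" where
  "ideal M Z (Answer b) = (\<lambda>T K. return_pmf b)"
| "ideal M Z (Random p A) = (\<lambda>T K. bind_pmf p (\<lambda>i. ideal M Z (A i) T K))"
| "ideal M Z (Sample A) = (\<lambda>T K. if T = 0 then return_pmf False
     else bind_pmf (pmf_of_set Z) (\<lambda>z. ideal M Z (A z) (T - 1) K))"
| "ideal M Z (Multiply z1 z2 A) = (\<lambda>T K. if T = 0 then return_pmf False
     else if z1 \<notin> Z \<or> z2 \<notin> Z then ideal M Z (A []) (T - 1) K
     else let K' = register z2 (register z1 K);
              w = add_word M (the (fst K' z1)) (the (fst K' z2))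
          in if \<exists>z. fst K' z = Some w then ideal M Z (A (SOME z. fst K' z = Some w)) (T - 1) K'
             else bind_pmf (pmf_of_set (Z - dom (fst K')))
                    (\<lambda>z. ideal M Z (A z) (T - 1) ((fst K')(z \<mapsto> w), snd K')))"

text \<open>As every unit word is known, a labelling that fits the knowledge determines the values
  of all variables; this keeps the count in \<open>card_consistent_ge\<close> free of repetition.
  The last clause bounds the number of variables by the number of known labels, and so by
  \<open>V\<close>.\<close>

definition valid_knowledge :: "int \<Rightarrow> bool list set \<Rightarrow> knowledge \<Rightarrow> bool" where
  "valid_knowledge M Z K \<longleftrightarrow> dom (fst K) \<subseteq> Z \<and> inj_on (fst K) (dom (fst K)) \<and>
     (\<forall>w\<in>ran (fst K). reduced_word M (snd K) w) \<and> (\<forall>i<snd K. unit_word i \<in> ran (fst K)) \<and>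
     snd K \<le> card (dom (fst K))"

lemma reduced_word_mono: "reduced_word M v w \<Longrightarrow> v \<le> v' \<Longrightarrow> reduced_word M v' w"
  unfolding reduced_word_def by auto

lemma valid_knowledge_update:
  assumes K: "valid_knowledge M Z K" and Z: "finite Z" "z \<in> Z" and z: "fst K z = None"
    and w: "reduced_word M v w" "w \<notin> ran (fst K)"
    and v: "v = snd K \<or> v = Suc (snd K) \<and> w = unit_word (snd K)"
  shows "valid_knowledge M Z ((fst K)(z \<mapsto> w), v)" "card (dom ((fst K)(z \<mapsto> w))) = Suc (card (dom (fst K)))"
proof -
  have fin: "finite (dom (fst K))" using K Z unfolding valid_knowledge_def by (blast intro: finite_subset)
  have zd: "z \<notin> dom (fst K)" using z by auto
  show card: "card (dom ((fst K)(z \<mapsto> w))) = Suc (card (dom (fst K)))" using fin zd by simp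
  have ran: "ran ((fst K)(z \<mapsto> w)) = insert w (ran (fst K))" using z by (rule ran_map_upd)
  have "inj_on ((fst K)(z \<mapsto> w)) (dom ((fst K)(z \<mapsto> w)))"
  proof -
    have "inj_on ((fst K)(z \<mapsto> w)) (dom (fst K))"
      using K zd unfolding valid_knowledge_def inj_on_def by auto
    moreover have "Some w \<notin> ((fst K)(z \<mapsto> w)) ` (dom (fst K))" 
      using w(2) zd by (auto simp: image_iff intro: ranI split: if_splits)
    ultimately show ?thesis using zd by simp
  qed
  then show "valid_knowledge M Z ((fst K)(z \<mapsto> w), v)"
    using K Z w v card reduced_word_mono[of M "snd K" _ v] unfolding valid_knowledge_def ran fst_conv snd_conv
    by (auto simp: less_Suc_eq)
qed

text \<open>The equation between sums says without subtraction that variables and known labels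
  increase by the same amount, in the form in which \<open>weight_mono\<close> expects it.\<close>

lemma register_valid:
  assumes K: "valid_knowledge M Z K" and Z: "finite Z" "z \<in> Z" and M: "M > 1"
  shows "valid_knowledge M Z (register z K)" "fst (register z K) z \<noteq> None" "fst K \<subseteq>\<^sub>m fst (register z K)"
    "snd (register z K) + card (dom (fst K)) = snd K + card (dom (fst (register z K)))"
    "card (dom (fst (register z K))) \<le> Suc (card (dom (fst K)))"
proof -
  have "unit_word (snd K) \<notin> ran (fst K)"
  proof
    assume "unit_word (snd K) \<in> ran (fst K)"
    then have "unit_word (snd K) (snd K) = 0" using K unfolding valid_knowledge_def reduced_word_def by auto
    then show False by (simp add: unit_word_def)
  qed
  moreover have "reduced_word M (Suc (snd K)) (unit_word (snd K))"
    using M unfolding reduced_word_def unit_word_def by auto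
  ultimately have *: "valid_knowledge M Z ((fst K)(z \<mapsto> unit_word (snd K)), Suc (snd K))"
    "card (dom ((fst K)(z \<mapsto> unit_word (snd K)))) = Suc (card (dom (fst K)))" if "fst K z = None"
    using valid_knowledge_update[OF K Z that, of "Suc (snd K)"] by auto
  show "valid_knowledge M Z (register z K)" "fst (register z K) z \<noteq> None"
    "snd (register z K) + card (dom (fst K)) = snd K + card (dom (fst (register z K)))"
    "card (dom (fst (register z K))) \<le> Suc (card (dom (fst K)))"
    using * K unfolding register_def by auto
  show "fst K \<subseteq>\<^sub>m fst (register z K)" unfolding register_def map_le_def by auto
qed

text \<open>n^v (n - d)! counts the labellings that fit d known labels in v variables when
  collisions are ignored: v free values, then any arrangement of the remaining labels. Making an
  unseen label a new variable multiplies this by n / (n - d) >= 1.\<close>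

lemma weight_mono:
  fixes n v v' d d' :: nat
  assumes "v' + d = v + d'" "d \<le> d'" "d' \<le> n"
  shows "real n ^ v * fact (n - d) \<le> real n ^ v' * fact (n - d')"
proof -
  obtain j where j: "d' = d + j" using assms(2) le_Suc_ex by blast
  then have v': "v' = v + j" using assms(1) by simp
  have "fact (n - d) \<le> real n ^ j * fact (n - d')"
    using assms(3) unfolding j
  proof (induction j)
    case (Suc j)
    have "n - (d + j) = Suc (n - (d + Suc j))" using Suc.prems by simp
    then have "(fact (n - (d + j)) :: real) = real (n - (d + j)) * fact (n - (d + Suc j))" by (metis fact_Suc of_nat_mult of_nat_fact)
    also have "\<dots> \<le> real n * fact (n - (d + Suc j))" by (intro mult_right_mono) auto
    finally have "real n ^ j * fact (n - (d + j)) \<le> real n ^ j * (real n * fact (n - (d + Suc j)))" by (intro mult_left_mono) auto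
    moreover have "fact (n - d) \<le> real n ^ j * fact (n - (d + j))" using Suc by simp
    ultimately have "fact (n - d) \<le> real n ^ j * (real n * fact (n - (d + Suc j)))" by linarith
    then show ?case by (simp only: power_Suc ac_simps)
  qed simp
  then have "real n ^ v * fact (n - d) \<le> real n ^ v * (real n ^ j * fact (n - d'))" by (intro mult_left_mono) auto
  then show ?thesis unfolding v' by (simp add: power_add ac_simps)
qed

text \<open>The number \<open>1 / Q\<close> bounds the probability that two distinct words coincide under a random
  evaluation of their at most \<open>V\<close> variables.\<close>

locale word_evaluation =
  fixes G :: "'g set" and add :: "'g \<Rightarrow> 'g \<Rightarrow> 'g" and ev :: "(nat \<Rightarrow> 'g) \<Rightarrow> (nat \<Rightarrow> int) \<Rightarrow> 'g"
    and M :: int and V :: nat and Q :: real and Z :: "bool list set" and \<beta> :: "bool list \<Rightarrow> 'g"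
  assumes fin_Z: "finite Z" and \<beta>: "bij_betw \<beta> Z G" and M: "M > 1"
    and ev_closed: "ev x w \<in> G"
    and ev_add: "ev x (add_word M w w') = add (ev x w) (ev x w')"
    and ev_unit: "v < V \<Longrightarrow> x v \<in> G \<Longrightarrow> ev x (unit_word v) = x v"
    and ev_collision: "v \<le> V \<Longrightarrow> reduced_word M v w \<Longrightarrow> reduced_word M v w' \<Longrightarrow> w \<noteq> w' \<Longrightarrow>
      Q * real (card {x \<in> PiE {..<v} (\<lambda>_. G). ev x w = ev x w'}) \<le> real (card G) ^ v"
    and V_le: "V \<le> card G" and Q: "Q > 0" "(real V)\<^sup>2 \<le> Q"
begin

text \<open>The value \<open>[]\<close> off \<open>Z\<close> is the one used by
  \<open>ideal\<close>, so such a query has the same answer in every labelling.\<close>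

definition labelled_mult :: "(bool list \<Rightarrow> bool list) \<Rightarrow> mult_oracle" where
  "labelled_mult \<sigma> z1 z2 = (if z1 \<in> Z \<and> z2 \<in> Z then inv_into Z (\<beta> \<circ> \<sigma>) (add (\<beta> (\<sigma> z1)) (\<beta> (\<sigma> z2))) else [])"

definition consistent :: "(bool list \<rightharpoonup> (nat \<Rightarrow> int)) \<Rightarrow> (bool list \<Rightarrow> bool list) set" where
  "consistent l = {\<sigma>. \<sigma> permutes Z \<and> (\<exists>x. \<forall>z w. l z = Some w \<longrightarrow> \<beta> (\<sigma> z) = ev x w)}"

lemma fin_G: "finite G" using \<beta> fin_Z bij_betw_finite by blast

lemma card_Z: "card Z = card G" using \<beta> by (rule bij_betw_same_card)

lemma collision_slack_nonneg: "0 \<le> 1 - (real V)\<^sup>2 / Q" using Q by simp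

lemma finite_consistent: "finite (consistent l)"
  unfolding consistent_def using finite_permutations[OF fin_Z] by (rule finite_subset[rotated]) auto

lemma consistent_anti_mono: "l \<subseteq>\<^sub>m l' \<Longrightarrow> consistent l' \<subseteq> consistent l"
  unfolding consistent_def map_le_def by (auto simp: dom_def)

lemma labelled_mult_consistent:
  assumes \<sigma>: "\<sigma> \<in> consistent l" and Z: "z1 \<in> Z" "z2 \<in> Z" "z \<in> Z"
    and l: "l z1 = Some w1" "l z2 = Some w2" "l z = Some (add_word M w1 w2)"
  shows "labelled_mult \<sigma> z1 z2 = z"
proof -
  have \<sigma>p: "\<sigma> permutes Z" using \<sigma> unfolding consistent_def by auto
  obtain x where x: "\<And>z w. l z = Some w \<Longrightarrow> \<beta> (\<sigma> z) = ev x w" using \<sigma> unfolding consistent_def by auto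
  have "bij_betw (\<beta> \<circ> \<sigma>) Z G" using permutes_imp_bij[OF \<sigma>p] \<beta> by (rule bij_betw_trans)
  moreover have "add (\<beta> (\<sigma> z1)) (\<beta> (\<sigma> z2)) = (\<beta> \<circ> \<sigma>) z" using x[OF l(1)] x[OF l(2)] x[OF l(3)] by (simp add: ev_add)
  ultimately show ?thesis unfolding labelled_mult_def using Z by (simp add: bij_betw_def inv_into_f_f del: o_apply)
qed

text \<open>Each assignment of the variables that gives the known words distinct values extends to
  (n - d)! labellings. A union bound over at most V^2 pairs of labels, each colliding with
  probability at most 1 / Q, removes at most the fraction V^2 / Q of the assignments.\<close>

lemma card_consistent_ge:
  assumes K: "valid_knowledge M Z K" and V: "card (dom (fst K)) \<le> V"
  shows "(1 - (real V)\<^sup>2 / Q) * (real (card G) ^ snd K * fact (card G - card (dom (fst K)))) \<le> real (card (consistent (fst K)))"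
proof -
  obtain l v where Klv: "K = (l, v)" by (cases K)
  define d where "d = card (dom l)"
  have dom: "dom l \<subseteq> Z" "inj_on l (dom l)" "\<And>z w. l z = Some w \<Longrightarrow> reduced_word M v w" "v \<le> V" "d \<le> V"
    "\<And>i. i < v \<Longrightarrow> \<exists>z. l z = Some (unit_word i)"
    using K V unfolding valid_knowledge_def Klv d_def by (auto simp: ran_def)
  have fin: "finite (dom l)" using dom fin_Z finite_subset by blast
  define X where "X = PiE {..<v} (\<lambda>_. G)"
  have finX: "finite X" unfolding X_def using fin_G by (intro finite_PiE) auto
  have cX: "card X = card G ^ v" unfolding X_def by (simp add: card_PiE)
  define bad where "bad = {x \<in> X. \<not> inj_on (\<lambda>z. ev x (the (l z))) (dom l)}"
  define pairs where "pairs = {(z, z') \<in> dom l \<times> dom l. z \<noteq> z'}"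
  have pairs: "finite pairs" "card pairs \<le> d * d"
  proof -
    have "pairs \<subseteq> dom l \<times> dom l" unfolding pairs_def by auto
    then show "finite pairs" "card pairs \<le> d * d" unfolding d_def
      using fin card_mono[of "dom l \<times> dom l" pairs] by (auto simp: card_cartesian_product intro: finite_subset)
  qed
  have "bad \<subseteq> (\<Union>(z, z')\<in>pairs. {x \<in> X. ev x (the (l z)) = ev x (the (l z'))})"
    unfolding bad_def pairs_def inj_on_def by auto
  then have "card bad \<le> card (\<Union>(z, z')\<in>pairs. {x \<in> X. ev x (the (l z)) = ev x (the (l z'))})"
    using finX pairs by (intro card_mono) auto
  also have "\<dots> \<le> (\<Sum>(z, z')\<in>pairs. card {x \<in> X. ev x (the (l z)) = ev x (the (l z'))})"
    using card_UN_le[OF pairs(1), of "\<lambda>(z, z'). {x \<in> X. ev x (the (l z)) = ev x (the (l z'))}"] by (simp add: case_prod_unfold)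
  finally have "real (card bad) \<le> (\<Sum>(z, z')\<in>pairs. real (card {x \<in> X. ev x (the (l z)) = ev x (the (l z'))}))"
    by (simp add: case_prod_unfold flip: of_nat_sum)
  also have "\<dots> \<le> (\<Sum>(z, z')\<in>pairs. real (card G) ^ v / Q)"
  proof (rule sum_mono, clarify)
    fix z z' assume "(z, z') \<in> pairs"
    then obtain w w' where w: "l z = Some w" "l z' = Some w'" "z \<noteq> z'" unfolding pairs_def by auto
    then have "w \<noteq> w'" using dom(2) unfolding inj_on_def by (metis domI)
    then have "Q * real (card {x \<in> X. ev x w = ev x w'}) \<le> real (card G) ^ v"
      unfolding X_def using dom w by (intro ev_collision) auto
    then show "real (card {x \<in> X. ev x (the (l z)) = ev x (the (l z'))}) \<le> real (card G) ^ v / Q"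
      using w Q by (simp add: pos_le_divide_eq mult.commute)
  qed
  also have "\<dots> = real (card pairs) * (real (card G) ^ v / Q)" by (simp add: case_prod_unfold)
  also have "\<dots> \<le> (real V)\<^sup>2 * (real (card G) ^ v / Q)"
  proof (rule mult_right_mono)
    have "d * d \<le> V * V" using dom(5) by (rule mult_le_mono[OF _ dom(5)])
    then have "card pairs \<le> V\<^sup>2" using pairs(2) by (simp add: power2_eq_square)
    then show "real (card pairs) \<le> (real V)\<^sup>2" by (metis of_nat_le_iff of_nat_power)
  qed (use Q in auto)
  finally have bad: "real (card bad) \<le> (real V)\<^sup>2 / Q * real (card G) ^ v" by simp
  define E where "E = (\<lambda>x. {\<sigma>. \<sigma> permutes Z \<and> (\<forall>z\<in>dom l. \<sigma> z = inv_into Z \<beta> (ev x (the (l z))))})"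
  have \<beta>i: "inv_into Z \<beta> g \<in> Z" "\<beta> (inv_into Z \<beta> g) = g" if "g \<in> G" for g
    using \<beta> that by (auto simp: bij_betw_def inv_into_into f_inv_into_f)
  have E: "fact (card G - d) \<le> card (E x)" if "x \<in> X - bad" for x
    unfolding E_def d_def card_Z[symmetric]
  proof (rule card_permutes_extending_ge[OF fin_Z dom(1)])
    have inj: "inj_on (\<lambda>z. ev x (the (l z))) (dom l)" using that unfolding bad_def by auto
    show "inj_on (\<lambda>z. inv_into Z \<beta> (ev x (the (l z)))) (dom l)"
    proof (rule inj_onI)
      fix z z' assume zz: "z \<in> dom l" "z' \<in> dom l" "inv_into Z \<beta> (ev x (the (l z))) = inv_into Z \<beta> (ev x (the (l z')))"
      then have "ev x (the (l z)) = ev x (the (l z'))" using \<beta>i(2) ev_closed by metis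
      then show "z = z'" using inj zz unfolding inj_on_def by blast
    qed
  qed (use \<beta>i ev_closed in auto)
  have E\<beta>: "\<beta> (\<sigma> z) = ev x w" if "\<sigma> \<in> E x" "l z = Some w" for \<sigma> x z w
    using that \<beta>i ev_closed unfolding E_def by (metis (mono_tags, lifting) domI mem_Collect_eq option.sel)
  have finE: "finite (E x)" for x
    unfolding E_def using finite_permutations[OF fin_Z] by (rule finite_subset[rotated]) auto
  have "(\<Union>x\<in>X - bad. E x) \<subseteq> consistent l"
  proof clarify
    fix x \<sigma> assume "\<sigma> \<in> E x"
    then show "\<sigma> \<in> consistent l" unfolding consistent_def using E\<beta>[of \<sigma> x] unfolding E_def by blast
  qed
  then have "card (\<Union>x\<in>X - bad. E x) \<le> card (consistent l)"
    using finite_consistent by (intro card_mono)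
  moreover have "card (\<Union>x\<in>X - bad. E x) = (\<Sum>x\<in>X - bad. card (E x))"
  proof (rule card_UN_disjoint)
    \<comment> \<open>The label that carries \<open>unit_word i\<close> reveals x i, so one
      labelling cannot arise from two assignments.\<close>
    show "\<forall>x\<in>X - bad. \<forall>y\<in>X - bad. x \<noteq> y \<longrightarrow> E x \<inter> E y = {}"
    proof (intro ballI impI, rule ccontr)
      fix x y assume xy: "x \<in> X - bad" "y \<in> X - bad" "x \<noteq> y" "E x \<inter> E y \<noteq> {}"
      then obtain \<sigma> where \<sigma>: "\<sigma> \<in> E x" "\<sigma> \<in> E y" by auto
      have "x i = y i" if i: "i < v" for i
      proof -
        obtain z where "l z = Some (unit_word i)" using dom(6)[OF i] by blast
        then have "ev x (unit_word i) = ev y (unit_word i)" using E\<beta> \<sigma> by metis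
        moreover have "x i \<in> G" "y i \<in> G" using xy i unfolding X_def by auto
        ultimately show ?thesis using i dom(4) ev_unit[of i] by auto
      qed
      then have "x = y" using xy unfolding X_def by (intro PiE_ext[of x "{..<v}" "\<lambda>_. G" y]) auto
      with xy show False by simp
    qed
  qed (use finX finE in auto)
  moreover have "(\<Sum>x\<in>X - bad. fact (card G - d)) \<le> (\<Sum>x\<in>X - bad. card (E x))"
    using E by (intro sum_mono) auto
  ultimately have "card (X - bad) * fact (card G - d) \<le> card (consistent l)" by simp
  then have le: "real (card (X - bad)) * fact (card G - d) \<le> real (card (consistent l))"
    by (metis of_nat_fact of_nat_le_iff of_nat_mult)
  have "real (card (X - bad)) = real (card X) - real (card bad)"
    using finX card_mono[of X bad] by (subst card_Diff_subset) (auto simp: bad_def of_nat_diff)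
  then have "(1 - (real V)\<^sup>2 / Q) * real (card G) ^ v \<le> real (card (X - bad))"
    using bad by (simp add: cX algebra_simps)
  then have "(1 - (real V)\<^sup>2 / Q) * real (card G) ^ v * fact (card G - d) \<le> real (card (X - bad)) * fact (card G - d)"
    by (intro mult_right_mono) auto
  with le have "(1 - (real V)\<^sup>2 / Q) * real (card G) ^ v * fact (card G - d) \<le> real (card (consistent l))" by linarith
  then show ?thesis unfolding Klv d_def fst_conv snd_conv by (simp only: mult.assoc)
qed

text \<open>The labellings on which two known words collide are simply dropped, which is why only a lower
  bound by the ideal run appears. Applied to both answers and both groups, one side is enough.\<close>

lemma sum_consistent_accept_prob_ge:
  assumes "valid_knowledge M Z K" "card (dom (fst K)) + 3 * T \<le> V"
  shows "(1 - (real V)\<^sup>2 / Q) * (real (card G) ^ snd K * fact (card G - card (dom (fst K)))) * pmf (ideal M Z A T K) b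
    \<le> (\<Sum>\<sigma>\<in>consistent (fst K). accept_prob (pmf_of_set Z) (labelled_mult \<sigma>) A b T)"
    (is "?\<kappa> * _ * _ \<le> _")
  using assms
proof (induction A arbitrary: T K)
  case (Answer b')
  then show ?case using card_consistent_ge[OF Answer(1)] by auto
next
  case (Random p A)
  show ?case
    unfolding accept_prob_Random ideal.simps pmf_bind
    by (rule sum_expectation_ge[OF finite_consistent Random.IH[OF rangeI Random.prems]])
      (auto simp: accept_prob_bounds pmf_le_1)
next
  case (Sample A)
  show ?case
  proof (cases T)
    \<comment> \<open>A query without budget counts as success, so the right side is the number of
      consistent labellings.\<close>
    case 0
    have "?\<kappa> * (real (card G) ^ snd K * fact (card G - card (dom (fst K)))) * pmf (ideal M Z (Sample A) T K) b
      \<le> ?\<kappa> * (real (card G) ^ snd K * fact (card G - card (dom (fst K))))"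
      using collision_slack_nonneg by (intro mult_left_le) (auto simp: pmf_le_1)
    then show ?thesis using card_consistent_ge[OF Sample.prems(1)] Sample.prems(2) 0 by simp
  next
    case (Suc T')
    then have T': "card (dom (fst K)) + 3 * T' \<le> V" using Sample.prems by simp
    \<comment> \<open>A sample is uniform on \<open>Z\<close> under every labelling and reveals
      nothing, so the knowledge stays as it is. A label receives a variable only when it is first
      multiplied.\<close>
    have "ideal M Z (Sample A) T K = bind_pmf (pmf_of_set Z) (\<lambda>z. ideal M Z (A z) T' K)" using Suc by simp
    then show ?thesis
      unfolding Suc accept_prob_Sample pmf_bind
      using sum_expectation_ge[OF finite_consistent Sample.IH[OF rangeI Sample.prems(1) T'], where p = "pmf_of_set Z"]
      by (simp add: accept_prob_bounds pmf_le_1 pmf_bind)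
  qed
next
  case (Multiply z1 z2 A)
  let ?W = "\<lambda>K. real (card G) ^ snd K * fact (card G - card (dom (fst K)))"
  show ?case
  proof (cases T)
    case 0
    have "?\<kappa> * ?W K * pmf (ideal M Z (Multiply z1 z2 A) T K) b \<le> ?\<kappa> * ?W K"
      using collision_slack_nonneg by (intro mult_left_le) (auto simp: pmf_le_1)
    then show ?thesis using card_consistent_ge[OF Multiply.prems(1)] Multiply.prems(2) 0 by simp
  next
    case (Suc T')
    show ?thesis
    proof (cases "z1 \<in> Z \<and> z2 \<in> Z")
      case False
      then have "ideal M Z (Multiply z1 z2 A) T K = ideal M Z (A []) T' K" using Suc by auto
      moreover have "labelled_mult \<sigma> z1 z2 = []" for \<sigma> using False unfolding labelled_mult_def by auto
      ultimately show ?thesis unfolding Suc using Multiply.IH[OF rangeI Multiply.prems(1), of T'] Multiply.prems(2) Suc by simp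
    next
      case True
      define K1 where "K1 = register z1 K"
      define K2 where "K2 = register z2 K1"
      define l where "l = fst K2"
      define d where "d = card (dom l)"
      note r1 = register_valid[OF Multiply.prems(1) fin_Z conjunct1[OF True] M, folded K1_def]
      note r2 = register_valid[OF r1(1) fin_Z conjunct2[OF True] M, folded K2_def]
      \<comment> \<open>Either factor may be a label never seen before, so registration adds up to
        two labels. The product may add a third: hence three labels per query, and the strict
        inequality that follows.\<close>
      have d: "d \<le> card (dom (fst K)) + 2" using r1(5) r2(5) unfolding d_def l_def by simp
      then have dT: "d + 3 * T' < V" using Multiply.prems(2) Suc by simp
      have le: "fst K \<subseteq>\<^sub>m l" using r1(3) r2(3) map_le_trans unfolding l_def by blast
      have finl: "finite (dom l)" and domZ: "dom l \<subseteq> Z"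
        using r2(1) fin_Z unfolding valid_knowledge_def l_def by (auto intro: finite_subset)
      obtain w1 where w1: "l z1 = Some w1" using r1(2) r2(3) unfolding l_def map_le_def by (metis domIff option.exhaust)
      obtain w2 where w2: "l z2 = Some w2" using r2(2) unfolding l_def by auto
      define w where "w = add_word M w1 w2"
      have w: "reduced_word M (snd K2) w"
      proof -
        have "reduced_word M (snd K2) w1" "reduced_word M (snd K2) w2"
          using r2(1) ranI[of "fst K2"] w1 w2 unfolding valid_knowledge_def l_def by blast+
        then show ?thesis using M unfolding w_def reduced_word_def add_word_def by auto
      qed
      have "?W K \<le> ?W K2"
        using r1(4,5) r2(4,5) dT V_le card_mono[OF finl map_le_implies_dom_le[OF le]] unfolding d_def l_def
        by (intro weight_mono) auto
      then have W: "?\<kappa> * ?W K * pmf q b \<le> ?\<kappa> * ?W K2 * pmf q b" for q :: "bool pmf"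
        using collision_slack_nonneg by (intro mult_right_mono mult_left_mono) auto
      let ?acc = "\<lambda>\<sigma>. accept_prob (pmf_of_set Z) (labelled_mult \<sigma>)"
      have sub: "(\<Sum>\<sigma>\<in>S. ?acc \<sigma> (Multiply z1 z2 A) b T) \<le> (\<Sum>\<sigma>\<in>consistent (fst K). ?acc \<sigma> (Multiply z1 z2 A) b T)"
        if "S \<subseteq> consistent l" for S
        using that consistent_anti_mono[OF le] finite_consistent accept_prob_bounds by (intro sum_mono2) auto
      show ?thesis
      proof (cases "\<exists>z. l z = Some w")
        \<comment> \<open>The product word is already known, so every consistent labelling is forced
          to answer with its label.\<close>
        case ex: True
        define z where "z = (SOME z. l z = Some w)"
        have lz: "l z = Some w" unfolding z_def using ex by (rule someI_ex)
        have ideal: "ideal M Z (Multiply z1 z2 A) T K = ideal M Z (A z) T' K2"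
          using True Suc ex unfolding z_def l_def w_def K2_def K1_def
          using w1 w2 unfolding l_def K2_def K1_def by (simp add: Let_def)
        have "?\<kappa> * ?W K2 * pmf (ideal M Z (A z) T' K2) b \<le> (\<Sum>\<sigma>\<in>consistent l. ?acc \<sigma> (A z) b T')"
          using Multiply.IH[OF rangeI r2(1), of T'] dT unfolding d_def l_def by simp
        also have "\<dots> = (\<Sum>\<sigma>\<in>consistent l. ?acc \<sigma> (Multiply z1 z2 A) b T)"
        proof (rule sum.cong[OF HOL.refl])
          fix \<sigma> assume "\<sigma> \<in> consistent l"
          then have "labelled_mult \<sigma> z1 z2 = z"
            using labelled_mult_consistent[of \<sigma> l z1 z2 z w1 w2] True lz w1 w2 domZ unfolding w_def by auto
          then show "?acc \<sigma> (A z) b T' = ?acc \<sigma> (Multiply z1 z2 A) b T" by (simp add: Suc)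
        qed
        also note sub[OF order_refl]
        finally show ?thesis using W[of "ideal M Z (A z) T' K2"] unfolding ideal by linarith
      next
        \<comment> \<open>Each fresh label z is treated on the labellings that give it to the
          product. For different z these are disjoint, since z is the answer to the query. The
          identity (n - d)! = (n - d) (n - d - 1)! cancels the average over the n - d fresh
          labels.\<close>
        case nex: False
        define N where "N = Z - dom l"
        have cN: "card N = card G - d" "card G - d = Suc (card G - Suc d)"
          using domZ finl dT V_le unfolding N_def d_def by (auto simp: card_Diff_subset card_Z)
        have N: "finite N" "N \<noteq> {}" using fin_Z cN by (simp add: N_def, metis card.empty nat.distinct(1))
        define q where "q = (\<lambda>z. pmf (ideal M Z (A z) T' (l(z \<mapsto> w), snd K2)) b)"
        have "ideal M Z (Multiply z1 z2 A) T K = bind_pmf (pmf_of_set N) (\<lambda>z. ideal M Z (A z) T' (l(z \<mapsto> w), snd K2))"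
          using True Suc nex unfolding N_def l_def w_def K2_def K1_def
          using w1 w2 unfolding l_def K2_def K1_def by (simp add: Let_def)
        then have ideal: "pmf (ideal M Z (Multiply z1 z2 A) T K) b = sum q N / real (card N)"
          using N unfolding q_def by (simp add: pmf_bind integral_pmf_of_set)
        have fresh: "l z = None" "z \<in> Z" if "z \<in> N" for z using that unfolding N_def by auto
        have ans: "labelled_mult \<sigma> z1 z2 = z" if "z \<in> N" "\<sigma> \<in> consistent (l(z \<mapsto> w))" for z \<sigma>
        proof -
          have "z \<noteq> z1" "z \<noteq> z2" using fresh(1)[OF that(1)] w1 w2 by auto
          then show ?thesis
            using labelled_mult_consistent[OF that(2), of z1 z2 z w1 w2] True w1 w2 fresh(2)[OF that(1)]
            unfolding w_def by simp
        qed
        have IH: "?\<kappa> * (real (card G) ^ snd K2 * fact (card G - Suc d)) * q z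
            \<le> (\<Sum>\<sigma>\<in>consistent (l(z \<mapsto> w)). ?acc \<sigma> (Multiply z1 z2 A) b T)" if z: "z \<in> N" for z
        proof -
          have "w \<notin> ran (fst K2)" using nex unfolding l_def by (auto simp: ran_def)
          note u = valid_knowledge_update[OF r2(1) fin_Z fresh(2)[OF z] fresh(1)[OF z, unfolded l_def] w this disjI1[OF HOL.refl], folded l_def]
          have "?\<kappa> * (real (card G) ^ snd K2 * fact (card G - Suc d)) * q z \<le> (\<Sum>\<sigma>\<in>consistent (l(z \<mapsto> w)). ?acc \<sigma> (A z) b T')"
            using Multiply.IH[OF rangeI[of A z] u(1), of T'] dT
            unfolding q_def d_def fst_conv snd_conv u(2) by linarith
          also have "\<dots> = (\<Sum>\<sigma>\<in>consistent (l(z \<mapsto> w)). ?acc \<sigma> (Multiply z1 z2 A) b T)"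
            using ans[OF z] by (intro sum.cong) (auto simp: Suc)
          finally show ?thesis .
        qed
        have "fact (card G - d) = real (card N) * fact (card G - Suc d)"
          unfolding cN(1) cN(2) by (simp only: fact_Suc of_nat_mult)
        moreover have "real (card N) \<noteq> 0" using cN by simp
        ultimately have "?\<kappa> * ?W K2 * (sum q N / real (card N))
            = ?\<kappa> * (real (card G) ^ snd K2 * fact (card G - Suc d)) * sum q N"
          unfolding l_def[symmetric] d_def[symmetric] by simp
        also have "\<dots> = (\<Sum>z\<in>N. ?\<kappa> * (real (card G) ^ snd K2 * fact (card G - Suc d)) * q z)"
          by (rule sum_distrib_left)
        also have "\<dots> \<le> (\<Sum>z\<in>N. \<Sum>\<sigma>\<in>consistent (l(z \<mapsto> w)). ?acc \<sigma> (Multiply z1 z2 A) b T)"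
          by (intro sum_mono IH)
        also have "\<dots> = (\<Sum>\<sigma>\<in>(\<Union>z\<in>N. consistent (l(z \<mapsto> w))). ?acc \<sigma> (Multiply z1 z2 A) b T)"
        proof (rule sum.UNION_disjoint[symmetric, OF N(1)])
          show "\<forall>z\<in>N. \<forall>z'\<in>N. z \<noteq> z' \<longrightarrow> consistent (l(z \<mapsto> w)) \<inter> consistent (l(z' \<mapsto> w)) = {}"
            using ans by blast
        qed (use finite_consistent in auto)
        also have "\<dots> \<le> (\<Sum>\<sigma>\<in>consistent (fst K). ?acc \<sigma> (Multiply z1 z2 A) b T)"
        proof (rule sub, rule UN_least)
          fix z assume "z \<in> N"
          then have "l \<subseteq>\<^sub>m l(z \<mapsto> w)" using fresh unfolding map_le_def by auto
          then show "consistent (l(z \<mapsto> w)) \<subseteq> consistent l" by (rule consistent_anti_mono)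
        qed
        finally show ?thesis using W[of "ideal M Z (Multiply z1 z2 A) T K"] unfolding ideal by linarith
      qed
    qed
  qed
qed

lemma sum_permutes_accept_prob_ge:
  assumes "3 * T \<le> V"
  shows "(1 - (real V)\<^sup>2 / Q) * fact (card G) * pmf (ideal M Z A T (Map.empty, 0)) b
    \<le> (\<Sum>\<sigma>\<in>{\<sigma>. \<sigma> permutes Z}. accept_prob (pmf_of_set Z) (labelled_mult \<sigma>) A b T)"
proof -
  have "consistent Map.empty = {\<sigma>. \<sigma> permutes Z}" unfolding consistent_def by simp
  moreover have "valid_knowledge M Z (Map.empty, 0)" unfolding valid_knowledge_def by simp
  ultimately show ?thesis
    using sum_consistent_accept_prob_ge[of "(Map.empty, 0)" T A b] assms by simp
qed

end

section \<open>Words in products of cyclic groups of order p and p squared\<close>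

definition mixed_moduli :: "nat \<Rightarrow> nat \<Rightarrow> nat \<Rightarrow> nat" where
  "mixed_moduli p a i = (if i < a then p\<^sup>2 else p)"

text \<open>The sum runs to the fixed bound \<open>V\<close> rather than to the number of variables
  in use. A reduced word vanishes beyond its variables, so the values of x there do not
  matter.\<close>

definition eval_word :: "nat \<Rightarrow> nat \<Rightarrow> nat \<Rightarrow> nat \<Rightarrow> (nat \<Rightarrow> nat \<Rightarrow> int) \<Rightarrow> (nat \<Rightarrow> int) \<Rightarrow> nat \<Rightarrow> int" where
  "eval_word p a r V x w = (\<lambda>j\<in>{..<r}. (\<Sum>i<V. w i * x i j) mod int (mixed_moduli p a j))"

lemma mixed_moduli_pos: "0 < p \<Longrightarrow> \<forall>i<r. 0 < mixed_moduli p a i"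
  unfolding mixed_moduli_def by simp

lemma card_mixed_product:
  assumes "0 < p" "a \<le> r"
  shows "card (carrier (cyclic_product r (mixed_moduli p a))) = p ^ (a + r)"
proof -
  have "card (carrier (cyclic_product r (mixed_moduli p a))) = (\<Prod>i<r. mixed_moduli p a i)"
    unfolding carrier_cyclic_product[OF mixed_moduli_pos[OF assms(1)]] by (simp add: card_PiE)
  also have "\<dots> = (\<Prod>i\<in>{..<a} \<union> {a..<r}. mixed_moduli p a i)" using assms(2) by (intro prod.cong) auto
  also have "(\<Prod>i\<in>{..<a} \<union> {a..<r}. mixed_moduli p a i) = (\<Prod>i<a. p\<^sup>2) * (\<Prod>i\<in>{a..<r}. p)"
    by (subst prod.union_disjoint) (auto simp: mixed_moduli_def)
  also have "\<dots> = p ^ (2 * a + (r - a))" by (simp add: power_add power_mult)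
  also have "2 * a + (r - a) = a + r" using assms(2) by simp
  finally show ?thesis .
qed

text \<open>If p^2 divides u (g - g') but not u, then p divides g - g'. On the first a coordinates
  all members of R thus agree modulo p and are determined by their quotients by p, so each of the r
  coordinates admits at most p values.\<close>

lemma card_collision_fiber_le:
  assumes p: "prime p" and u: "\<not> int (p\<^sup>2) dvd u"
    and R: "R \<subseteq> carrier (cyclic_product r (mixed_moduli p a))"
    and diff: "\<And>g g' j. g \<in> R \<Longrightarrow> g' \<in> R \<Longrightarrow> j < r \<Longrightarrow> int (mixed_moduli p a j) dvd u * (g j - g' j)"
  shows "card R \<le> p ^ r"
proof -
  have p0: "0 < p" using p by (simp add: prime_gt_0_nat)
  have R': "R \<subseteq> PiE {..<r} (\<lambda>i. {0..<int (mixed_moduli p a i)})"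
    using R unfolding carrier_cyclic_product[OF mixed_moduli_pos[OF p0]] .
  define F where "F = (\<lambda>g::nat \<Rightarrow> int. \<lambda>j\<in>{..<r}. if j < a then g j div int p else g j)"
  have "inj_on F R"
  proof (rule inj_onI)
    fix g g' assume g: "g \<in> R" "g' \<in> R" "F g = F g'"
    show "g = g'"
    proof (rule PiE_ext)
      show "g \<in> PiE {..<r} (\<lambda>i. {0..<int (mixed_moduli p a i)})" "g' \<in> PiE {..<r} (\<lambda>i. {0..<int (mixed_moduli p a i)})"
        using g R' by auto
      fix j assume j: "j \<in> {..<r}"
      have Fj: "F g j = F g' j" using g(3) by simp
      show "g j = g' j"
      proof (cases "j < a")
        case False
        then show ?thesis using Fj j unfolding F_def by simp
      next
        case True
        have "int p * int p dvd u * (g j - g' j)"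
          using diff[OF g(1,2), of j] j True unfolding mixed_moduli_def by (simp add: power2_eq_square)
        moreover have "prime (int p)" using p by simp
        ultimately have "int p dvd g j - g' j"
          using u p0 by (metis coprime_commute coprime_dvd_mult_right_iff dvd_mult_cancel_left dvd_mult_left mult.commute
              of_nat_mult power2_eq_square prime_dvd_mult_iff prime_imp_coprime coprime_mult_left_iff)
        then have "g j mod int p = g' j mod int p" by (simp add: mod_eq_dvd_iff)
        moreover have "g j div int p = g' j div int p" using Fj j True unfolding F_def by simp
        ultimately show ?thesis by (metis div_mult_mod_eq)
      qed
    qed
  qed
  moreover have "F ` R \<subseteq> PiE {..<r} (\<lambda>_. {0..<int p})"
  proof (rule image_subsetI)
    fix g assume "g \<in> R"
    then have g: "g j \<in> {0..<int (mixed_moduli p a j)}" if "j < r" for j using R' that by (auto simp: PiE_iff)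
    have "F g j \<in> {0..<int p}" if j: "j < r" for j
    proof (cases "j < a")
      case True
      then have gj: "0 \<le> g j" "g j < int p * int p"
        using g[OF j] unfolding mixed_moduli_def by (auto simp: power2_eq_square)
      have "g j = g j div int p * int p + g j mod int p" "0 \<le> g j mod int p" using p0 by auto
      with gj(2) have "g j div int p * int p < int p * int p" by linarith
      then have "g j div int p < int p" using p0 by simp
      moreover have "0 \<le> g j div int p" using gj(1) by (simp add: div_int_pos_iff)
      ultimately show ?thesis using True j unfolding F_def by simp
    next
      case False
      then show ?thesis using g[OF j] j unfolding F_def mixed_moduli_def by simp
    qed
    then show "F g \<in> PiE {..<r} (\<lambda>_. {0..<int p})" by (auto simp: F_def)
  qed
  moreover have "finite (PiE {..<r} (\<lambda>_. {0..<int p}))" by (intro finite_PiE) auto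
  ultimately have "card R \<le> card (PiE {..<r} (\<lambda>_. {0..<int p}))" by (intro card_inj_on_le)
  then show ?thesis by (simp add: card_PiE)
qed

lemma card_le_card_times_fiber:
  assumes "finite B" "finite S" "f ` S \<subseteq> B" "\<And>y. y \<in> B \<Longrightarrow> card {x \<in> S. f x = y} \<le> c"
  shows "card S \<le> card B * c"
proof -
  have "S = (\<Union>y\<in>B. {x \<in> S. f x = y})" using assms(3) by auto
  then have "card S \<le> (\<Sum>y\<in>B. card {x \<in> S. f x = y})" using card_UN_le[OF assms(1)] by metis
  also have "\<dots> \<le> (\<Sum>y\<in>B. c)" using assms(4) by (intro sum_mono)
  finally show ?thesis by simp
qed

text \<open>Distinct reduced words differ at some variable i0, by a coefficient that p^2 does not
  divide. Once the other variables are fixed, at most p^r of the p^(a + r) values of that variable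
  give a collision.\<close>

lemma card_word_collision:
  assumes p: "prime p" and a: "a \<le> r" and v: "v \<le> V"
    and w: "reduced_word (int (p\<^sup>2)) v w" "reduced_word (int (p\<^sup>2)) v w'" "w \<noteq> w'"
  shows "p ^ a * card {x \<in> PiE {..<v} (\<lambda>_. carrier (cyclic_product r (mixed_moduli p a))).
      eval_word p a r V x w = eval_word p a r V x w'} \<le> card (carrier (cyclic_product r (mixed_moduli p a))) ^ v"
    (is "_ * card ?S \<le> card ?G ^ v")
proof -
  have p0: "0 < p" using p by (simp add: prime_gt_0_nat)
  note finG = finite_cyclic_product[OF mixed_moduli_pos[OF p0]]
  obtain i0 where i0: "w i0 \<noteq> w' i0" using w(3) by (auto simp: fun_eq_iff)
  have "i0 < v" using i0 w(1,2) unfolding reduced_word_def by (metis not_le)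
  define u where "u = w i0 - w' i0"
  have u: "\<not> int (p\<^sup>2) dvd u"
  proof
    assume "int (p\<^sup>2) dvd u"
    moreover have "0 \<le> w i0 \<and> w i0 < int (p\<^sup>2)" "0 \<le> w' i0 \<and> w' i0 < int (p\<^sup>2)"
      using w(1,2) unfolding reduced_word_def by blast+
    then have "\<bar>u\<bar> < int (p\<^sup>2)" unfolding u_def by linarith
    ultimately have "u = 0" using dvd_imp_le_int[of u "int (p\<^sup>2)"] by linarith
    then show False using i0 unfolding u_def by simp
  qed
  let ?I = "{..<v} - {i0}"
  let ?B = "PiE ?I (\<lambda>_. ?G)"
  have finS: "finite ?S" using finG by (auto intro!: finite_subset[OF _ finite_PiE[of "{..<v}" "\<lambda>_. ?G"]])
  have "card ?S \<le> card ?B * p ^ r"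
  proof (rule card_le_card_times_fiber[where f = "\<lambda>x. restrict x ?I"])
    show "finite ?B" using finG by (intro finite_PiE) auto
    show "finite ?S" by fact
    show "(\<lambda>x. restrict x ?I) ` ?S \<subseteq> ?B"
    proof (rule image_subsetI)
      fix x assume "x \<in> ?S"
      then have "x i \<in> ?G" if "i < v" for i using PiE_mem[of x "{..<v}" "\<lambda>_. ?G" i] that by blast
      then show "restrict x ?I \<in> ?B" unfolding restrict_PiE_iff by blast
    qed
    fix y assume "y \<in> ?B"
    let ?F = "{x \<in> ?S. restrict x ?I = y}"
    have agree: "x i = x' i" if "x \<in> ?F" "x' \<in> ?F" "i < v" "i \<noteq> i0" for x x' i
    proof -
      have "restrict x ?I i = restrict x' ?I i" using that(1,2) by auto
      then show ?thesis using that(3,4) by simp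
    qed
    have "inj_on (\<lambda>x. x i0) ?F"
    proof (rule inj_onI)
      fix x x' assume x: "x \<in> ?F" "x' \<in> ?F" "x i0 = x' i0"
      then have "x \<in> PiE {..<v} (\<lambda>_. ?G)" "x' \<in> PiE {..<v} (\<lambda>_. ?G)" by auto
      then show "x = x'"
        by (rule PiE_ext) (use agree[OF x(1,2)] x(3) in \<open>metis lessThan_iff\<close>)
    qed
    then have "card ?F = card ((\<lambda>x. x i0) ` ?F)" by (simp add: card_image)
    also have "\<dots> \<le> p ^ r"
    proof (rule card_collision_fiber_le[OF p u])
      show "(\<lambda>x. x i0) ` ?F \<subseteq> ?G" 
      proof (rule image_subsetI)
        fix x assume "x \<in> ?F"
        then show "x i0 \<in> ?G" using PiE_mem[of x "{..<v}" "\<lambda>_. ?G" i0] \<open>i0 < v\<close> by blast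
      qed
      fix g g' j assume "g \<in> (\<lambda>x. x i0) ` ?F" "g' \<in> (\<lambda>x. x i0) ` ?F" and j: "j < r"
      then obtain x x' where x: "x \<in> ?F" "x' \<in> ?F" "g = x i0" "g' = x' i0" by blast
      let ?m = "int (mixed_moduli p a j)"
      have ev: "?m dvd (\<Sum>i<V. w i * x i j) - (\<Sum>i<V. w' i * x i j)" if "x \<in> ?F" for x
      proof -
        have "eval_word p a r V x w j = eval_word p a r V x w' j" using that by auto
        then show ?thesis using j unfolding eval_word_def by (simp add: mod_eq_dvd_iff)
      qed
      have "(\<Sum>i<V. w i * x i j) - (\<Sum>i<V. w' i * x i j) - ((\<Sum>i<V. w i * x' i j) - (\<Sum>i<V. w' i * x' i j))
          = (\<Sum>i<V. (w i - w' i) * (x i j - x' i j))"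
        by (simp add: sum_subtractf[symmetric] algebra_simps)
      also have "\<dots> = (\<Sum>i\<in>{i0}. (w i - w' i) * (x i j - x' i j))"
      proof (rule sum.mono_neutral_right)
        show "\<forall>i\<in>{..<V} - {i0}. (w i - w' i) * (x i j - x' i j) = 0"
        proof
          fix i assume i: "i \<in> {..<V} - {i0}"
          show "(w i - w' i) * (x i j - x' i j) = 0"
          proof (cases "i < v")
            case True
            then show ?thesis using agree[OF x(1,2), of i] i by simp
          next
            case False
            then show ?thesis using w(1,2) unfolding reduced_word_def by simp
          qed
        qed
      qed (use \<open>i0 < v\<close> v in auto)
      finally show "?m dvd u * (g j - g' j)"
        using dvd_diff[OF ev[OF x(1)] ev[OF x(2)]] x(3,4) unfolding u_def by simp
    qed
    finally show "card ?F \<le> p ^ r" .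
  qed
  also have "card ?B = card ?G ^ (v - 1)" using \<open>i0 < v\<close> by (simp add: card_PiE)
  finally have "p ^ a * card ?S \<le> p ^ a * (card ?G ^ (v - 1) * p ^ r)" by simp
  also have "\<dots> = card ?G ^ (v - 1) * card ?G"
    unfolding card_mixed_product[OF p0 a] by (simp add: power_add)
  also have "\<dots> = card ?G ^ v" using \<open>i0 < v\<close> by (metis gr_implies_not0 power_minus_mult neq0_conv)
  finally show ?thesis .
qed

text \<open>Stating the bound as p^b for any b <= a lets two groups with different numbers of
  factors of order p^2 share one Q, as \<open>no_common_distinguisher\<close> requires.\<close>

lemma word_evaluation_mixed_product:
  assumes p: "prime p" and a: "b \<le> a" "a \<le> r"
    and Z: "finite Z" "bij_betw \<beta> Z (carrier (cyclic_product r (mixed_moduli p a)))"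
    and V: "V \<le> p ^ (a + r)" "(real V)\<^sup>2 \<le> real (p ^ b)"
  shows "word_evaluation (carrier (cyclic_product r (mixed_moduli p a))) (mult (cyclic_product r (mixed_moduli p a)))
    (eval_word p a r V) (int (p\<^sup>2)) V (real (p ^ b)) Z \<beta>"
proof
  have p0: "0 < p" using p by (simp add: prime_gt_0_nat)
  let ?m = "mixed_moduli p a"
  note carrier = carrier_cyclic_product[OF mixed_moduli_pos[OF p0]]
  have mpos: "0 < ?m j" for j using p0 unfolding mixed_moduli_def by simp
  show "finite Z" "bij_betw \<beta> Z (carrier (cyclic_product r ?m))" by fact+
  show "1 < int (p\<^sup>2)" using p prime_gt_1_nat[of p] by (simp add: one_less_power)
  show "eval_word p a r V x w \<in> carrier (cyclic_product r ?m)" for x w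
    unfolding carrier eval_word_def using mpos by (auto simp: zero_less_mult_iff)
  show "eval_word p a r V x (add_word (int (p\<^sup>2)) w w')
      = eval_word p a r V x w \<otimes>\<^bsub>cyclic_product r ?m\<^esub> eval_word p a r V x w'" for x w w'
  proof
    fix j
    \<comment> \<open>Every modulus of the product divides p^2, so coefficients may be reduced
      modulo p^2 before evaluation.\<close>
    have dvd: "int (?m j) dvd int (p\<^sup>2)" unfolding mixed_moduli_def by (auto simp: power2_eq_square)
    have "(\<Sum>i<V. ((w i + w' i) mod int (p\<^sup>2)) * x i j) mod int (?m j) = (\<Sum>i<V. (w i + w' i) * x i j) mod int (?m j)"
    proof (subst (1 2) mod_sum_eq[symmetric], rule arg_cong[where f = "\<lambda>s. s mod int (?m j)"], rule sum.cong)
      fix i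
      show "((w i + w' i) mod int (p\<^sup>2)) * x i j mod int (?m j) = (w i + w' i) * x i j mod int (?m j)"
        by (metis dvd mod_mod_cancel mod_mult_left_eq)
    qed simp
    also have "\<dots> = ((\<Sum>i<V. w i * x i j) + (\<Sum>i<V. w' i * x i j)) mod int (?m j)"
      by (simp add: distrib_right sum.distrib)
    finally show "eval_word p a r V x (add_word (int (p\<^sup>2)) w w') j
      = (eval_word p a r V x w \<otimes>\<^bsub>cyclic_product r ?m\<^esub> eval_word p a r V x w') j"
      unfolding eval_word_def add_word_def by (simp add: mod_add_eq)
  qed
  show "eval_word p a r V x (unit_word v) = x v" if "v < V" "x v \<in> carrier (cyclic_product r ?m)" for x v
  proof
    fix j
    have "(\<Sum>i<V. unit_word v i * x i j) = (\<Sum>i\<in>{v}. unit_word v i * x i j)"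
      by (rule sum.mono_neutral_right) (use that(1) in \<open>auto simp: unit_word_def\<close>)
    then have "(\<Sum>i<V. unit_word v i * x i j) = x v j" by (simp add: unit_word_def)
    then show "eval_word p a r V x (unit_word v) j = x v j"
      using that(2) unfolding eval_word_def carrier by (auto simp: PiE_iff extensional_def)
  qed
  show "real (p ^ b) * real (card {x \<in> PiE {..<v} (\<lambda>_. carrier (cyclic_product r ?m)). eval_word p a r V x w = eval_word p a r V x w'})
      \<le> real (card (carrier (cyclic_product r ?m))) ^ v"
    if "v \<le> V" "reduced_word (int (p\<^sup>2)) v w" "reduced_word (int (p\<^sup>2)) v w'" "w \<noteq> w'" for v w w'
  proof -
    have "p ^ b \<le> p ^ a" using a(1) p0 by (intro power_increasing) auto
    then have "p ^ b * card {x \<in> PiE {..<v} (\<lambda>_. carrier (cyclic_product r ?m)). eval_word p a r V x w = eval_word p a r V x w'}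
      \<le> card (carrier (cyclic_product r ?m)) ^ v"
      using card_word_collision[OF p a(2) that] by (meson le_trans mult_le_mono1)
    from of_nat_mono[OF this, where 'a = real] show ?thesis by (simp only: of_nat_mult of_nat_power)
  qed
  show "V \<le> card (carrier (cyclic_product r ?m))" using V(1) card_mixed_product[OF p0 a(2)] by simp
  show "0 < real (p ^ b)" using p0 by simp
  show "(real V)\<^sup>2 \<le> real (p ^ b)" by fact
qed

section \<open>The lower bound\<close>

lemma comm_group_cyclic_product: "comm_group (cyclic_product r m)"
proof (rule group.group_comm_groupI)
  show "group (cyclic_product r m)" by simp
  show "x \<otimes>\<^bsub>cyclic_product r m\<^esub> y = y \<otimes>\<^bsub>cyclic_product r m\<^esub> x" for x y
    by (simp add: add.commute)
qed

lemma comm_group_transport: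
  assumes P: "comm_group P" and bij: "bij_betw dec \<Gamma> (carrier P)"
    and f: "f = (\<lambda>x y. inv_into \<Gamma> dec (dec x \<otimes>\<^bsub>P\<^esub> dec y))" and e: "e = inv_into \<Gamma> dec \<one>\<^bsub>P\<^esub>"
  shows "comm_group \<lparr>carrier = \<Gamma>, monoid.mult = f, one = e\<rparr>" "\<lparr>carrier = \<Gamma>, monoid.mult = f, one = e\<rparr> \<cong> P"
proof -
  interpret P: comm_group P by fact
  let ?H = "\<lparr>carrier = \<Gamma>, monoid.mult = f, one = e\<rparr>"
  let ?enc = "inv_into \<Gamma> dec"
  have enc: "bij_betw ?enc (carrier P) \<Gamma>" using bij by (rule bij_betw_inv_into)
  have dec: "dec (?enc g) = g" "?enc g \<in> \<Gamma>" if "g \<in> carrier P" for g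
    using bij that bij_betw_inv_into_right[OF bij that] bij_betwE[OF enc] by auto
  have iso: "?enc \<in> iso P ?H"
    using enc unfolding iso_def hom_def f by (auto simp: dec)
  from P.iso_imp_img_comm_group[OF this] show "comm_group ?H" unfolding e by simp
  show "?H \<cong> P" using P.iso_sym[of ?H] iso unfolding is_iso_def by blast
qed

text \<open>Permuting the labels changes only the encoding, so the oracles for all
  \<open>\<sigma>\<close> belong to one fixed magma and the guarantee of a tester covers each of
  them.\<close>

lemma binary_structure_relabelling:
  assumes Z: "finite Z" "Z \<noteq> {}" "Z \<subseteq> strings q" "card Z \<le> q"
    and \<beta>: "bij_betw \<beta> Z (carrier P)" and \<sigma>: "\<sigma> permutes Z" and bij: "bij_betw dec \<Gamma> (carrier P)"
    and f: "f = (\<lambda>x y. inv_into \<Gamma> dec (dec x \<otimes>\<^bsub>P\<^esub> dec y))" and P: "group P"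
    and O2: "\<And>z1 z2. z1 \<in> Z \<Longrightarrow> z2 \<in> Z \<Longrightarrow> O2 z1 z2 = inv_into Z (\<beta> \<circ> \<sigma>) (\<beta> (\<sigma> z1) \<otimes>\<^bsub>P\<^esub> \<beta> (\<sigma> z2))"
  shows "binary_structure \<Gamma> f q (pmf_of_set Z) O2"
proof -
  interpret P: group P by fact
  define \<rho> where "\<rho> = \<beta> \<circ> \<sigma>"
  have \<rho>: "bij_betw \<rho> Z (carrier P)" unfolding \<rho>_def using permutes_imp_bij[OF \<sigma>] \<beta> by (rule bij_betw_trans)
  define \<pi> where "\<pi> = inv_into Z \<rho> \<circ> dec"
  have \<pi>: "bij_betw \<pi> \<Gamma> Z" unfolding \<pi>_def using bij bij_betw_inv_into[OF \<rho>] by (rule bij_betw_trans)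
  then have \<Gamma>: "finite \<Gamma>" "\<Gamma> \<noteq> {}" "card \<Gamma> = card Z"
    using Z bij_betw_finite bij_betw_same_card by (blast, force simp: bij_betw_def, blast)
  have dec\<pi>: "dec (inv_into \<Gamma> \<pi> z) = \<rho> z" if "z \<in> Z" for z
  proof -
    have x: "inv_into \<Gamma> \<pi> z \<in> \<Gamma>" "\<pi> (inv_into \<Gamma> \<pi> z) = z"
      using that \<pi> bij_betw_inv_into_right[OF \<pi>] bij_betwE[OF bij_betw_inv_into[OF \<pi>]] by auto
    then have "dec (inv_into \<Gamma> \<pi> z) \<in> carrier P" using bij_betwE[OF bij] by blast
    then show ?thesis using bij_betw_inv_into_right[OF \<rho>] x(2) unfolding \<pi>_def by force
  qed
  have "O2 z1 z2 = \<pi> (f (inv_into \<Gamma> \<pi> z1) (inv_into \<Gamma> \<pi> z2))" if z: "z1 \<in> Z" "z2 \<in> Z" for z1 z2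
  proof -
    have "\<rho> z1 \<otimes>\<^bsub>P\<^esub> \<rho> z2 \<in> carrier P" using z bij_betwE[OF \<rho>] by blast
    then have "\<pi> (f (inv_into \<Gamma> \<pi> z1) (inv_into \<Gamma> \<pi> z2)) = inv_into Z \<rho> (\<rho> z1 \<otimes>\<^bsub>P\<^esub> \<rho> z2)"
      unfolding f dec\<pi>[OF z(1)] dec\<pi>[OF z(2)] using bij_betw_inv_into_right[OF bij] by (simp add: \<pi>_def)
    then show ?thesis using O2[OF z] unfolding \<rho>_def by simp
  qed
  moreover have "\<pi> ` \<Gamma> = Z" "inj_on \<pi> \<Gamma>" using \<pi> by (auto simp: bij_betw_def)
  moreover have "pmf_of_set Z = map_pmf \<pi> (pmf_of_set \<Gamma>)"
    using map_pmf_of_set_bij_betw[OF \<pi> \<Gamma>(2,1)] by simp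
  ultimately show ?thesis unfolding binary_structure_def using Z(3,4) \<Gamma>(3) by auto
qed

lemma finite_card_strings:
  assumes "0 < q"
  shows "finite (strings q)" "q \<le> card (strings q)"
proof -
  define L where "L = nat \<lceil>log 2 (real q)\<rceil>"
  have s: "strings q = {z. set z \<subseteq> (UNIV :: bool set) \<and> length z = L}" unfolding strings_def L_def by simp
  show "finite (strings q)" unfolding s by (rule finite_lists_length_eq) simp
  have "log 2 (real q) \<le> real L" unfolding L_def by linarith
  then have "real q \<le> 2 powr real L" using assms by (simp add: log_le_iff)
  then have "real q \<le> real (2 ^ L)" by (simp add: powr_realpow)
  moreover have "card (strings q) = 2 ^ L" unfolding s by (subst card_lists_length_eq) auto
  ultimately show "q \<le> card (strings q)" by (metis of_nat_le_iff)
qed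

text \<open>Both groups are compared with the same \<open>ideal\<close> run, whose two answers have
  total probability 1. By 3 V^2 < Q the factor \<open>\<kappa>\<close> exceeds 2/3, whereas the two
  error bounds of 1/3 would make it at most 2/3.\<close>

lemma no_common_distinguisher:
  assumes W0: "word_evaluation G0 add0 ev0 M V Q Z \<beta>0" and W1: "word_evaluation G1 add1 ev1 M V Q Z \<beta>1"
    and V: "3 * T \<le> V" "3 * (real V)\<^sup>2 < Q"
    and acc0: "\<And>\<sigma>. \<sigma> permutes Z \<Longrightarrow>
      accept_prob (pmf_of_set Z) (word_evaluation.labelled_mult add0 Z \<beta>0 \<sigma>) A False T \<le> 1/3"
    and acc1: "\<And>\<sigma>. \<sigma> permutes Z \<Longrightarrow>
      accept_prob (pmf_of_set Z) (word_evaluation.labelled_mult add1 Z \<beta>1 \<sigma>) A True T \<le> 1/3"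
  shows False
proof -
  interpret W0: word_evaluation G0 add0 ev0 M V Q Z \<beta>0 by fact
  interpret W1: word_evaluation G1 add1 ev1 M V Q Z \<beta>1 by fact
  define \<kappa> where "\<kappa> = 1 - (real V)\<^sup>2 / Q"
  have \<kappa>: "\<kappa> > 2/3" using V(2) W0.Q(1) unfolding \<kappa>_def by (simp add: field_simps)
  define F :: real where "F = fact (card Z)"
  have F: "F > 0" unfolding F_def by simp
  define I where "I = ideal M Z A T (Map.empty, 0)"
  have card: "real (card {\<sigma>. \<sigma> permutes Z}) = F"
    unfolding F_def using card_permutations[OF HOL.refl W0.fin_Z] by simp
  have "\<kappa> * F * pmf I False \<le> (\<Sum>\<sigma>\<in>{\<sigma>. \<sigma> permutes Z}. accept_prob (pmf_of_set Z) (W0.labelled_mult \<sigma>) A False T)"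
    using W0.sum_permutes_accept_prob_ge[OF V(1), of A False] unfolding \<kappa>_def F_def I_def W0.card_Z .
  also have "\<dots> \<le> (\<Sum>\<sigma>\<in>{\<sigma>. \<sigma> permutes Z}. 1/3)" using acc0 by (intro sum_mono) auto
  finally have 0: "\<kappa> * F * pmf I False \<le> F / 3" using card by simp
  have "\<kappa> * F * pmf I True \<le> (\<Sum>\<sigma>\<in>{\<sigma>. \<sigma> permutes Z}. accept_prob (pmf_of_set Z) (W1.labelled_mult \<sigma>) A True T)"
    using W1.sum_permutes_accept_prob_ge[OF V(1), of A True] unfolding \<kappa>_def F_def I_def W1.card_Z .
  also have "\<dots> \<le> (\<Sum>\<sigma>\<in>{\<sigma>. \<sigma> permutes Z}. 1/3)" using acc1 by (intro sum_mono) auto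
  finally have 1: "\<kappa> * F * pmf I True \<le> F / 3" using card by simp
  have "\<kappa> * F * pmf I False + \<kappa> * F * pmf I True = \<kappa> * F"
    by (simp add: pmf_False_conv_True algebra_simps)
  with 0 1 have "\<kappa> * F \<le> 2/3 * F" by linarith
  then show False using \<kappa> F by simp
qed

lemma accept_prob_if_few_queries:
  assumes "\<And>b c. (b, c) \<in> set_pmf (run O1 O2 A) \<Longrightarrow> c \<le> T"
  shows "accept_prob O1 O2 A b T = pmf (map_pmf fst (run O1 O2 A)) b"
proof -
  have "accept_prob O1 O2 A b T = pmf (map_pmf (\<lambda>b'. b' = b) (map_pmf fst (run O1 O2 A))) True"
    unfolding accept_prob_def map_pmf_comp
    by (rule arg_cong[where f = "\<lambda>q. pmf q True"], rule map_pmf_cong) (use assms in \<open>force+\<close>)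
  also have "\<dots> = pmf (map_pmf fst (run O1 O2 A)) b"
  proof -
    have "inj (\<lambda>b'. b' = b)" by (cases b) (auto intro: injI)
    from pmf_map_inj'[OF this, of "map_pmf fst (run O1 O2 A)" b] show ?thesis by simp
  qed
  finally show ?thesis .
qed

lemma tester_query_lower_bound:
  assumes p: "prime p" and a: "Suc a \<le> k" and n: "n = p ^ (a + Suc k)" and q: "n \<le> q"
    and \<epsilon>: "\<epsilon> \<le> 1/23" and far: "far \<in> {hamming_far, edit_far}"
    and A: "eps_tester far (abelian_generated_by k) \<epsilon> A"
  shows "ereal (1/6 * sqrt (real p ^ a)) \<le> ereal_of_enat (query_complexity A n q)"
proof (rule ccontr)
  assume "\<not> ?thesis"
  then have less: "ereal_of_enat (query_complexity A n q) < ereal (1/6 * sqrt (real p ^ a))" by simp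
  then obtain T where T: "query_complexity A n q = enat T" by (cases "query_complexity A n q") auto
  have T6: "6 * real T < sqrt (real p ^ a)" using less unfolding T by simp
  have p0: "0 < p" "2 \<le> p" using p prime_gt_0_nat prime_ge_2_nat by auto
  \<comment> \<open>Three labels per query. From 6 T < sqrt (p^a) follows 3 V^2 = 27 T^2 <= 36 T^2 <
    p^a, which is where the constant 1/6 comes from.\<close>
  define V where "V = 3 * T"
  have "(6 * real T)\<^sup>2 < real p ^ a" using T6 by (metis of_nat_0_le_iff mult_nonneg_nonneg power2_less_imp_less real_less_rsqrt
      real_sqrt_less_iff real_sqrt_pow2_iff real_sqrt_abs abs_of_nonneg zero_le_numeral)
  then have "36 * (real T * real T) < real p ^ a" by (simp add: power2_eq_square)
  then have "27 * (real T * real T) < real p ^ a" using zero_le_square[of "real T"] by linarith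
  then have V3: "3 * (real V)\<^sup>2 < real (p ^ a)" unfolding V_def by (simp add: power2_eq_square)
  then have V2: "(real V)\<^sup>2 \<le> real (p ^ a)" by (smt (verit) zero_le_power2)
  have "real (V * V) \<le> real (p ^ a)" using V2 by (simp add: power2_eq_square)
  then have "V * V \<le> p ^ a" by (simp only: of_nat_le_iff)
  also have "\<dots> \<le> n" unfolding n using p0 by (intro power_increasing) auto
  finally have Vn: "V \<le> n" by (metis le_square le_trans)
  have "0 < n" using p0 unfolding n by simp
  obtain Z where Z: "Z \<subseteq> strings q" "card Z = n" "finite Z"
    using obtain_subset_with_card_n[of n "strings q"] finite_card_strings[of q] q \<open>0 < n\<close> by (metis less_le_trans le_trans)
  have Zne: "Z \<noteq> {}" using Z \<open>0 < n\<close> by auto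
  define \<Gamma> where "\<Gamma> = {..<n}"
  have card\<Gamma>: "card \<Gamma> = n" unfolding \<Gamma>_def by simp
  \<comment> \<open>Applied with (b, r) = (a + 1, k) for the group in the class and (a, k + 1) for
    the far one; the condition on b + r fixes the common order n.\<close>
  have real: "\<exists>\<beta> f e. comm_group \<lparr>carrier = \<Gamma>, monoid.mult = f, one = e\<rparr> \<and>
      \<lparr>carrier = \<Gamma>, monoid.mult = f, one = e\<rparr> \<cong> cyclic_product r (mixed_moduli p b) \<and>
      word_evaluation (carrier (cyclic_product r (mixed_moduli p b))) (mult (cyclic_product r (mixed_moduli p b)))
        (eval_word p b r V) (int (p\<^sup>2)) V (real (p ^ a)) Z \<beta> \<and>
      (\<forall>\<sigma>. \<sigma> permutes Z \<longrightarrow> binary_structure \<Gamma> f q (pmf_of_set Z)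
        (word_evaluation.labelled_mult (mult (cyclic_product r (mixed_moduli p b))) Z \<beta> \<sigma>))"
    if b: "a \<le> b" "b \<le> r" "b + r = a + Suc k" for b r
  proof -
    let ?P = "cyclic_product r (mixed_moduli p b)"
    have cP: "card (carrier ?P) = n" using card_mixed_product[OF p0(1) b(2)] b(3) n by simp
    have finP: "finite (carrier ?P)" by (rule finite_cyclic_product[OF mixed_moduli_pos[OF p0(1)]])
    obtain \<beta> where \<beta>: "bij_betw \<beta> Z (carrier ?P)" using finite_same_card_bij[OF Z(3) finP] cP Z(2) by auto
    obtain dec where dec: "bij_betw dec \<Gamma> (carrier ?P)"
      using finite_same_card_bij[of \<Gamma>, OF _ finP] cP unfolding \<Gamma>_def by auto
    define f where "f = (\<lambda>x y. inv_into \<Gamma> dec (dec x \<otimes>\<^bsub>?P\<^esub> dec y))"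
    define e where "e = inv_into \<Gamma> dec \<one>\<^bsub>?P\<^esub>"
    have W: "word_evaluation (carrier ?P) (mult ?P) (eval_word p b r V) (int (p\<^sup>2)) V (real (p ^ a)) Z \<beta>"
      using word_evaluation_mixed_product[OF p b(1,2) Z(3) \<beta>, of V] V2 Vn n b(3) by simp
    moreover have "binary_structure \<Gamma> f q (pmf_of_set Z) (word_evaluation.labelled_mult (mult ?P) Z \<beta> \<sigma>)"
      if \<sigma>: "\<sigma> permutes Z" for \<sigma>
    proof (rule binary_structure_relabelling[OF Z(3) Zne Z(1) _ \<beta> \<sigma> dec f_def])
      show "card Z \<le> q" using Z(2) q by simp
      show "group ?P" by simp
      show "word_evaluation.labelled_mult (mult ?P) Z \<beta> \<sigma> z1 z2 = inv_into Z (\<beta> \<circ> \<sigma>) (\<beta> (\<sigma> z1) \<otimes>\<^bsub>?P\<^esub> \<beta> (\<sigma> z2))"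
        if "z1 \<in> Z" "z2 \<in> Z" for z1 z2
        unfolding word_evaluation.labelled_mult_def[OF W] using that by simp
    qed
    ultimately show ?thesis using comm_group_transport[OF comm_group_cyclic_product dec f_def e_def] by blast
  qed
  \<comment> \<open>No run on these structures exceeds T queries, so the truncated acceptance
    probability is the true one.\<close>
  have few: "accept_prob O1 O2 (A n q) b T = pmf (map_pmf fst (run O1 O2 (A n q))) b"
    if "binary_structure \<Gamma> f q O1 O2" "magma \<Gamma> f" for f O1 O2 b
  proof (rule accept_prob_if_few_queries)
    fix b c assume "(b, c) \<in> set_pmf (run O1 O2 (A n q))"
    then have "enat c \<le> query_complexity A n q"
      unfolding query_complexity_def using that card\<Gamma> by (intro Sup_upper) blast
    then show "c \<le> T" unfolding T by simp
  qed
  have magma: "magma \<Gamma> f" if "comm_group \<lparr>carrier = \<Gamma>, monoid.mult = f, one = e\<rparr>" for f e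
  proof -
    interpret comm_group "\<lparr>carrier = \<Gamma>, monoid.mult = f, one = e\<rparr>" by fact
    show ?thesis unfolding magma_def using m_closed one_closed by (auto simp: \<Gamma>_def)
  qed
  obtain \<beta>0 f0 e0 where 0: "comm_group \<lparr>carrier = \<Gamma>, monoid.mult = f0, one = e0\<rparr>"
      "\<lparr>carrier = \<Gamma>, monoid.mult = f0, one = e0\<rparr> \<cong> cyclic_product k (mixed_moduli p (Suc a))"
      "word_evaluation (carrier (cyclic_product k (mixed_moduli p (Suc a)))) (mult (cyclic_product k (mixed_moduli p (Suc a))))
        (eval_word p (Suc a) k V) (int (p\<^sup>2)) V (real (p ^ a)) Z \<beta>0"
      "\<And>\<sigma>. \<sigma> permutes Z \<Longrightarrow> binary_structure \<Gamma> f0 q (pmf_of_set Z)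
        (word_evaluation.labelled_mult (mult (cyclic_product k (mixed_moduli p (Suc a)))) Z \<beta>0 \<sigma>)"
    using real[of "Suc a" k] a by auto
  obtain \<beta>1 f1 e1 where 1: "comm_group \<lparr>carrier = \<Gamma>, monoid.mult = f1, one = e1\<rparr>"
      "\<lparr>carrier = \<Gamma>, monoid.mult = f1, one = e1\<rparr> \<cong> cyclic_product (Suc k) (mixed_moduli p a)"
      "word_evaluation (carrier (cyclic_product (Suc k) (mixed_moduli p a))) (mult (cyclic_product (Suc k) (mixed_moduli p a)))
        (eval_word p a (Suc k) V) (int (p\<^sup>2)) V (real (p ^ a)) Z \<beta>1"
      "\<And>\<sigma>. \<sigma> permutes Z \<Longrightarrow> binary_structure \<Gamma> f1 q (pmf_of_set Z)
        (word_evaluation.labelled_mult (mult (cyclic_product (Suc k) (mixed_moduli p a))) Z \<beta>1 \<sigma>)"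
    using real[of a "Suc k"] a by auto
  have C0: "abelian_generated_by k \<Gamma> f0"
    unfolding abelian_generated_by_def using 0(1,2) mixed_moduli_pos[OF p0(1), of k "Suc a"] a by (intro exI conjI) auto
  have C1: "far (abelian_generated_by k) \<epsilon> \<Gamma> f1"
  proof (rule cyclic_product_far[OF _ _ 1(2) _ p0(2) _ \<epsilon> far])
    show "group \<lparr>carrier = \<Gamma>, monoid.mult = f1, one = e1\<rparr>" using 1(1) by (simp add: comm_group_def)
    show "finite \<Gamma>" unfolding \<Gamma>_def by simp
    show "0 < mixed_moduli p a i \<and> p dvd mixed_moduli p a i" for i
      using p0 unfolding mixed_moduli_def by simp
  qed simp
  show False
  proof (rule no_common_distinguisher[OF 0(3) 1(3), of T "A n q"])
    show "3 * T \<le> V" unfolding V_def by simp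
    show "3 * (real V)\<^sup>2 < real (p ^ a)" by fact
    fix \<sigma> assume \<sigma>: "\<sigma> permutes Z"
    have "2/3 \<le> pmf (map_pmf fst (run (pmf_of_set Z) (word_evaluation.labelled_mult (mult (cyclic_product k (mixed_moduli p (Suc a)))) Z \<beta>0 \<sigma>) (A n q))) True"
      using A 0(4)[OF \<sigma>] C0 magma[OF 0(1)] unfolding eps_tester_def card\<Gamma>[symmetric] by blast
    then show "accept_prob (pmf_of_set Z) (word_evaluation.labelled_mult (mult (cyclic_product k (mixed_moduli p (Suc a)))) Z \<beta>0 \<sigma>) (A n q) False T \<le> 1/3"
      unfolding few[OF 0(4)[OF \<sigma>] magma[OF 0(1)]] pmf_False_conv_True by simp
    have "2/3 \<le> pmf (map_pmf fst (run (pmf_of_set Z) (word_evaluation.labelled_mult (mult (cyclic_product (Suc k) (mixed_moduli p a))) Z \<beta>1 \<sigma>) (A n q))) False"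
      using A 1(4)[OF \<sigma>] C1 magma[OF 1(1)] unfolding eps_tester_def card\<Gamma>[symmetric] by blast
    then show "accept_prob (pmf_of_set Z) (word_evaluation.labelled_mult (mult (cyclic_product (Suc k) (mixed_moduli p a))) Z \<beta>1 \<sigma>) (A n q) True T \<le> 1/3"
      unfolding few[OF 1(4)[OF \<sigma>] magma[OF 1(1)]] pmf_False_conv_True by simp
  qed
qed

text \<open>Rounding the d-th root of N up to a power of two loses a factor 2, and the window that
  contains the prime has ratio 4; hence 8^d.\<close>

lemma eventually_prime_power_between:
  assumes "0 < d"
  shows "\<forall>\<^sub>F N in sequentially. \<exists>p::nat. prime p \<and> p ^ d \<in> {N..8 ^ d * N}"
proof -
  obtain j0 where j0: "\<And>j. j0 \<le> j \<Longrightarrow> \<exists>p::nat. prime p \<and> 2 ^ j < p \<and> p \<le> 4 * 2 ^ j"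
    using eventually_prime_between_pow2 unfolding eventually_sequentially by blast
  have "\<exists>p::nat. prime p \<and> p ^ d \<in> {N..8 ^ d * N}" if N: "(2 ^ j0) ^ d < N" for N
  proof -
    have ex: "\<exists>j. N \<le> (2 ^ j) ^ d"
    proof
      have "N \<le> 2 ^ N" by (simp add: less_imp_le)
      also have "\<dots> \<le> (2 ^ N) ^ d" using assms by (simp add: self_le_power)
      finally show "N \<le> (2 ^ N) ^ d" .
    qed
    define j where "j = (LEAST j. N \<le> (2 ^ j) ^ d)"
    have j: "N \<le> (2 ^ j) ^ d" unfolding j_def by (rule LeastI_ex[OF ex])
    have "j0 < j"
    proof (rule ccontr)
      assume "\<not> j0 < j"
      then have "((2::nat) ^ j) ^ d \<le> (2 ^ j0) ^ d" by (intro power_mono power_increasing) auto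
      with j N show False by simp
    qed
    then obtain i where i: "j = Suc i" by (cases j) auto
    have "\<not> N \<le> (2 ^ i) ^ d" using not_less_Least[of i "\<lambda>j. N \<le> (2 ^ j) ^ d"] i unfolding j_def by simp
    then have iN: "(2 ^ i) ^ d \<le> N" by simp
    obtain p :: nat where p: "prime p" "2 ^ j < p" "p \<le> 4 * 2 ^ j" using j0[of j] \<open>j0 < j\<close> by auto
    have "N \<le> p ^ d" using j p(2) power_mono[of "2 ^ j" p d] by simp
    moreover have "p ^ d \<le> (8 * 2 ^ i) ^ d" using p(3) i by (intro power_mono) auto
    then have "p ^ d \<le> 8 ^ d * N" using iN by (metis le_trans mult_le_mono2 power_mult_distrib)
    ultimately show ?thesis using p(1) by auto
  qed
  then show ?thesis using eventually_gt_at_top[of "(2 ^ j0) ^ d"] by (rule eventually_mono[rotated])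
qed

text \<open>For n = p^(a + k + 1) the condition on s says that n^s = sqrt (p^a).\<close>

lemma tester_Omega:
  assumes a: "Suc a \<le> k" and \<epsilon>: "\<epsilon> \<le> 1/23" and far: "far \<in> {hamming_far, edit_far}"
    and A: "eps_tester far (abelian_generated_by k) \<epsilon> A"
    and s: "s * real (a + Suc k) = real a / 2"
  shows "query_complexity_Omega A s"
proof -
  let ?d = "a + Suc k"
  have "\<forall>\<^sub>F N in sequentially. \<exists>n\<in>{N..8 ^ ?d * N}. \<forall>q\<ge>n.
        ereal (1/6 * real n powr s) \<le> ereal_of_enat (query_complexity A n q)"
    using eventually_prime_power_between[OF zero_less_Suc, of "a + k"] unfolding add_Suc_right
  proof eventually_elim
    case (elim N)
    then obtain p where p: "prime p" "p ^ ?d \<in> {N..8 ^ ?d * N}" by auto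
    then have p0: "0 < real p" using prime_gt_0_nat by simp
    have "real (p ^ ?d) powr s = real p powr (s * real ?d)"
      using p0 by (simp only: of_nat_power powr_realpow[symmetric] powr_powr mult.commute)
    also have "\<dots> = sqrt (real p ^ a)"
      unfolding s using p0 by (simp add: powr_half_sqrt[symmetric] powr_realpow[symmetric] powr_powr)
    finally show ?case
      using tester_query_lower_bound[OF p(1) a HOL.refl _ \<epsilon> far A] p(2) by (intro bexI[of _ "p ^ ?d"]) auto
  qed
  then show ?thesis unfolding query_complexity_Omega_def by (intro exI[of _ "1/6"] conjI exI[of _ "8 ^ ?d"]) auto
qed

theorem theorem2:
  fixes k :: nat and \<epsilon> :: real
  assumes "k \<ge> 2" and "0 < \<epsilon>" and "\<epsilon> \<le> 1/23"
  shows "\<forall>far\<in>{hamming_far, edit_far}. \<forall>A. eps_tester far (abelian_generated_by k) \<epsilon> A \<longrightarrow>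
           (even k \<longrightarrow> query_complexity_Omega A (1/6 - 2 / (6 * (3 * real k + 2)))) \<and>
           (odd k \<longrightarrow> query_complexity_Omega A (1/6 - 4 / (6 * (3 * real k + 1))))"
proof (intro ballI allI impI conjI)
  fix far A
  assume far: "far \<in> {hamming_far, edit_far}" and A: "eps_tester far (abelian_generated_by k) \<epsilon> A"
  show "query_complexity_Omega A (1/6 - 2 / (6 * (3 * real k + 2)))" if "even k"
  proof -
    obtain j where j: "k = 2 * j" using \<open>even k\<close> by blast
    \<comment> \<open>With a = j the exponent a / (2 (a + k + 1)) is j / (6 j + 2), which is the
      stated one.\<close>
    show ?thesis
      by (rule tester_Omega[of j, OF _ assms(3) far A]) (use j assms(1) in \<open>auto simp: field_simps\<close>)
  qed
  show "query_complexity_Omega A (1/6 - 4 / (6 * (3 * real k + 1)))" if "odd k"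
  proof -
    obtain j where j: "k = 2 * j + 1" using \<open>odd k\<close> oddE by blast
    \<comment> \<open>Again a = j, now with exponent j / (6 j + 4).\<close>
    show ?thesis
      by (rule tester_Omega[of j, OF _ assms(3) far A]) (use j assms(1) in \<open>auto simp: field_simps\<close>)
  qed
qed

end
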